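(* Let $\{Y_t\}$ be the unique stationary solution $Y_t=\sum_{i\ge0}a_i\epsilon_{t-i}$ of $Y_t=\sum_{i=1}^d\phi_iY_{t-i}+\epsilon_t$, with $1-\sum_i\phi_iz^i$ having roots outside the closed unit disk and iid innovations having a Lebesgue density and a finite $\delta$-moment for some $\delta>0$, $\epsilon_t$ independent of $\sigma\{Y_s,s\le t-1\}$. Fix $h\ge1$, $p\in(0,1)$, and suppose $Y_t,\dots,Y_{t-n+1}$ ($n\ge d$) are observed. Let $\widehat\phi=\widehat\phi(n)$ be an estimator of $\phi$ with $\widehat\phi\to\phi$ in probability as $n\to\infty$. With $\Phi=(\phi\ e_1\cdots e_{d-1})$, $\widehat\Phi=(\widehat\phi\ e_1\cdots e_{d-1})$, set $\phi(h)=\Phi^he_1$, $\widehat\phi(h)=\widehat\Phi^he_1$, $Z_{t-k}=Y_{(t-k):(t-k-d+1)}=(Y_{t-k},\dots,Y_{t-k-d+1})^\top$, $\widehat Y_{t+h}(\phi)=\phi(h)^\top Z_t$, $\widehat Y_{t+h}(\widehat\phi)=\widehat\phi(h)^\top Z_t$, and \[ \widehat U_{t+h}=\frac{1}{n-d+1}\sum_{k=0}^{n-d}\mathbb{I}\big(\widehat\phi(h)^\top Z_{t-k}\le \widehat Y_{t+h}(\widehat\phi)\big),\qquad U^*_{t+h}=\mathbb{P}_Z\big(\phi(h)^\top Z\le \widehat Y_{t+h}(\phi)\big), \] where $Z$ has the same distribution as $Z_t$ and is independent of $(Z_t,\widehat\phi)$, and $\mathbb{P}_Z$ denotes probability with respect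 to $Z$ only. Suppose $\widehat Y_{t+h}(\phi)$ has a density with respect to Lebesgue measure and the marginal CDF $F_Y$ of $Y_t$ is continuous at $F_Y^{\leftarrow}(p)$. Then, as $n\to\infty$: (i) $\mathbb{P}[\widehat U_{t+h}\ge p]\to 1-p=\mathbb{P}[Y_{t+h}\ge F_Y^{\leftarrow}(p)]$; (ii) $\mathbb{P}(Y_{t+h}\ge F_Y^{\leftarrow}(p)\mid \widehat U_{t+h}\ge p)\to \mathbb{P}(Y_{t+h}\ge F_Y^{\leftarrow}(p)\mid U^*_{t+h}\ge p)$.
   Context: $F_Y^{\leftarrow}(p)=\inf\{y:F_Y(y)\ge p\}$; $e_1,\dots,e_{d-1}$ are the first standard basis vectors of $\mathbb{R}^d$. *)

theory Defs
  imports "HOL-Probability.Probability"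
begin

text \<open>Square matrices of size d are represented as functions nat => nat => real,
  only entries with indices < d being relevant; vectors as nat => real (indices < d).
  Indices are 0-based: row/column 0 corresponds to the paper's index 1.\<close>

definition mat_mul :: "nat \<Rightarrow> (nat \<Rightarrow> nat \<Rightarrow> real) \<Rightarrow> (nat \<Rightarrow> nat \<Rightarrow> real) \<Rightarrow> nat \<Rightarrow> nat \<Rightarrow> real" where
  "mat_mul d A B = (\<lambda>i j. \<Sum>k<d. A i k * B k j)"

definition mat_id :: "nat \<Rightarrow> nat \<Rightarrow> real" where
  "mat_id = (\<lambda>i j. if i = j then 1 else 0)"

primrec mat_pow :: "nat \<Rightarrow> (nat \<Rightarrow> nat \<Rightarrow> real) \<Rightarrow> nat \<Rightarrow> nat \<Rightarrow> nat \<Rightarrow> real" where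
  "mat_pow d A 0 = mat_id"
| "mat_pow d A (Suc h) = mat_mul d A (mat_pow d A h)"

text \<open>The matrix Phi = (phi e_1 ... e_(d-1)), with phi given 1-indexed as phi 1, ..., phi d:
  first column is phi, column j (0-based, 1 <= j <= d-1) is the j-th standard basis vector.\<close>
definition companion :: "nat \<Rightarrow> (nat \<Rightarrow> real) \<Rightarrow> nat \<Rightarrow> nat \<Rightarrow> real" where
  "companion d \<phi> = (\<lambda>i j. if j = 0 then \<phi> (Suc i) else if i = j - 1 then 1 else 0)"

definition phi_h :: "nat \<Rightarrow> (nat \<Rightarrow> real) \<Rightarrow> nat \<Rightarrow> nat \<Rightarrow> real" where
  "phi_h d \<phi> h = (\<lambda>i. mat_pow d (companion d \<phi>) h i 0)"

text \<open>Coefficients a_i of the causal MA(infinity) representation: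
  sum_i a_i z^i = 1 / (1 - sum_{i=1}^d phi_i z^i).\<close>
fun ma_coeff :: "nat \<Rightarrow> (nat \<Rightarrow> real) \<Rightarrow> nat \<Rightarrow> real" where
  "ma_coeff d \<phi> j = (if j = 0 then 1 else (\<Sum>i\<in>{1..min j d}. \<phi> i * ma_coeff d \<phi> (j - i)))"

definition gen_inv :: "(real \<Rightarrow> real) \<Rightarrow> real \<Rightarrow> real" where
  "gen_inv F p = Inf {y. F y \<ge> p}"

end

theory Submission
  imports Defs
begin

text \<open>The oracle rank is the probability integral transform of the oracle forecast $W_t$, hence
  uniform, and it suffices that the events $\widehat U_{t+h}\ge p$ and $U^*_{t+h}\ge p$ differ with
  vanishing probability. Since both ranks are monotone in the forecast, no Glivenko--Cantelli theorem
  is needed: choose $y_1<y_2$ where the distribution function of the forecast equals $p-\alpha$ and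
  $p+\alpha$. If $W_t$ lies outside a slight enlargement of $[y_1,y_2]$, then a weak law of large numbers
  for the events $W_{t-k}\le y_j$, together with consistency of the estimator and tightness of
  $Z_{t-k}$, decides both events in the same way.

  The weak law follows from Chebyshev's inequality and mixing: $W_s$ is a measurable function of the
  innovations up to time $s$, truncating it to the last $g$ innovations changes the event
  $W_s\le y$ with small probability, and the truncated forecast is independent of the past
  before time $s-g$.\<close>

section \<open>Comparing probabilities of events\<close>

text \<open>Dominated convergence applied to indicators. It turns pathwise statements into vanishing
  probabilities, once for truncation errors and once for tightness.\<close>

lemma (in prob_space) prob_eventually_not_tendsto_0:
  assumes [measurable]: "\<And>n. C n \<in> events"
    and ev: "AE \<omega> in M. \<forall>\<^sub>F n in sequentially. \<omega> \<notin> C n"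
  shows "(\<lambda>n. prob (C n)) \<longlonglongrightarrow> 0"
proof -
  have "(\<lambda>n. \<integral>\<omega>. indicator (C n) \<omega> \<partial>M) \<longlonglongrightarrow> (\<integral>\<omega>. (0::real) \<partial>M)"
  proof (rule integral_dominated_convergence)
    show "AE \<omega> in M. (\<lambda>n. indicator (C n) \<omega> :: real) \<longlonglongrightarrow> 0"
      using ev
    proof eventually_elim
      case (elim \<omega>)
      then show ?case
        by (intro tendsto_eventually) (auto elim!: eventually_mono)
    qed
    show "integrable M (\<lambda>_. 1::real)" by simp
  qed (auto simp: indicator_def)
  then show ?thesis by simp
qed

lemma (in prob_space) prob_eq_diff_le:
  assumes [measurable]: "Measurable.pred M P" "Measurable.pred M Q"
  shows "\<bar>\<P>(\<omega> in M. P \<omega>) - \<P>(\<omega> in M. Q \<omega>)\<bar> \<le> \<P>(\<omega> in M. P \<omega> \<noteq> Q \<omega>)"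
proof -
  have "\<P>(\<omega> in M. P \<omega>) \<le> prob ({\<omega>\<in>space M. Q \<omega>} \<union> {\<omega>\<in>space M. P \<omega> \<noteq> Q \<omega>})"
    by (rule finite_measure_mono) auto
  also have "\<dots> \<le> \<P>(\<omega> in M. Q \<omega>) + \<P>(\<omega> in M. P \<omega> \<noteq> Q \<omega>)"
    by (rule measure_Un_le) auto
  finally have 1: "\<P>(\<omega> in M. P \<omega>) \<le> \<P>(\<omega> in M. Q \<omega>) + \<P>(\<omega> in M. P \<omega> \<noteq> Q \<omega>)" .
  have "\<P>(\<omega> in M. Q \<omega>) \<le> prob ({\<omega>\<in>space M. P \<omega>} \<union> {\<omega>\<in>space M. P \<omega> \<noteq> Q \<omega>})"
    by (rule finite_measure_mono) auto
  also have "\<dots> \<le> \<P>(\<omega> in M. P \<omega>) + \<P>(\<omega> in M. P \<omega> \<noteq> Q \<omega>)"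
    by (rule measure_Un_le) auto
  finally show ?thesis using 1 by linarith
qed

subsection \<open>Weak law of large numbers\<close>

text \<open>Chebyshev's inequality. The second moment of the centred sum is a double sum of
  covariances: pairs at distance at least \<open>m\<close> contribute at most \<open>e\<close> each,
  and the few remaining pairs in each row at most 1 each. An upper bound on joint probabilities
  therefore suffices.\<close>

lemma (in prob_space) weak_law_mixing_events:
  fixes A :: "nat \<Rightarrow> 'a set" and q \<delta> :: real
  assumes A[measurable]: "\<And>k. A k \<in> events" and q: "\<And>k. prob (A k) = q"
    and mix: "\<And>e. e > 0 \<Longrightarrow> \<exists>m. \<forall>k l. k + m \<le> l \<longrightarrow> prob (A k \<inter> A l) \<le> q\<^sup>2 + e"
    and \<delta>: "\<delta> > 0"
  shows "(\<lambda>N. \<P>(\<omega> in M. \<delta> \<le> \<bar>(\<Sum>k<N. indicator (A k) \<omega>) / real N - q\<bar>)) \<longlonglongrightarrow> 0"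
proof (rule LIMSEQ_I)
  fix r :: real assume r: "r > 0"
  \<comment> \<open>After division by \<open>\<delta>\<^sup>2\<close>, the distant pairs account for
    r / 4 of the final bound.\<close>
  define e where "e = r * \<delta>\<^sup>2 / 4"
  have e: "e > 0" using r \<delta> by (simp add: e_def)
  obtain m where m: "\<And>k l. k + m \<le> l \<Longrightarrow> prob (A k \<inter> A l) \<le> q\<^sup>2 + e"
    using mix[OF e] by blast
  define a where "a k \<omega> = (indicator (A k) \<omega> - q :: real)" for k \<omega>
  have q01: "0 \<le> q" "q \<le> 1" using q[of 0] prob_le_1[of "A 0"] measure_nonneg[of M "A 0"] by auto
  have a_meas[measurable]: "a k \<in> borel_measurable M" for k
    unfolding a_def by measurable
  have a_prod: "a k \<omega> * a l \<omega> =
      indicator (A k \<inter> A l) \<omega> - q * indicator (A k) \<omega> - q * indicator (A l) \<omega> + q\<^sup>2" for k l \<omega>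
    by (auto simp: a_def indicator_def power2_eq_square algebra_simps)
  have a_int: "integrable M (\<lambda>\<omega>. a k \<omega> * a l \<omega>)" for k l
    unfolding a_prod by (intro Bochner_Integration.integrable_add Bochner_Integration.integrable_diff
      integrable_mult_right integrable_const integrable_real_indicator)
      (auto simp: emeasure_eq_measure)
  have cov: "(\<integral>\<omega>. a k \<omega> * a l \<omega> \<partial>M) = prob (A k \<inter> A l) - q\<^sup>2" for k l
  proof -
    have i: "integrable M (indicator B :: 'a \<Rightarrow> real)" if "B \<in> events" for B
      using that by (intro integrable_real_indicator) (auto simp: emeasure_eq_measure)
    have "(\<integral>\<omega>. a k \<omega> * a l \<omega> \<partial>M) = prob (A k \<inter> A l) - q * prob (A k) - q * prob (A l) + q\<^sup>2"
      unfolding a_prod by (simp add: i prob_space)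
    then show ?thesis by (simp add: q power2_eq_square)
  qed
  have cov_e: "(\<integral>\<omega>. a k \<omega> * a l \<omega> \<partial>M) \<le> e" if "k + m \<le> l \<or> l + m \<le> k" for k l
    using that m[of k l] m[of l k] by (auto simp: cov Int_commute)
  have cov_1: "(\<integral>\<omega>. a k \<omega> * a l \<omega> \<partial>M) \<le> 1" for k l
    unfolding cov using prob_le_1[of "A k \<inter> A l"] by (smt (verit) zero_le_power2)
  \<comment> \<open>Only the indices within distance \<open>m\<close> of \<open>k\<close> escape the
    mixing bound, and there are at most 2 m + 1 of them.\<close>
  have row: "(\<Sum>l<N. \<integral>\<omega>. a k \<omega> * a l \<omega> \<partial>M) \<le> real N * e + (2 * real m + 1)" for k N
  proof -
    have "(\<Sum>l<N. \<integral>\<omega>. a k \<omega> * a l \<omega> \<partial>M) \<le> (\<Sum>l<N. e + (if l \<in> {k-m..k+m} then 1 else 0))"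
    proof (intro sum_mono)
      fix l
      show "(\<integral>\<omega>. a k \<omega> * a l \<omega> \<partial>M) \<le> e + (if l \<in> {k-m..k+m} then 1 else 0)"
      proof (cases "l \<in> {k-m..k+m}")
        case False
        then have "k + m \<le> l \<or> l + m \<le> k" by (simp; linarith)
        from cov_e[OF this] False show ?thesis by auto
      qed (use cov_1[of k l] e in auto)
    qed
    also have "\<dots> = real N * e + real (card ({..<N} \<inter> {k-m..k+m}))"
      by (simp add: sum.distrib sum.If_cases atLeastAtMost_def atLeast_def atMost_def Int_def)
    also have "card ({..<N} \<inter> {k-m..k+m}) \<le> card {k-m..k+m}"
      by (intro card_mono) auto
    then have "real (card ({..<N} \<inter> {k-m..k+m})) \<le> 2 * real m + 1"
      by (simp; linarith)
    finally show ?thesis by simp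
  qed
  define S where "S N \<omega> = (\<Sum>k<N. a k \<omega>)" for N \<omega>
  have S2: "(S N \<omega>)\<^sup>2 = (\<Sum>k<N. \<Sum>l<N. a k \<omega> * a l \<omega>)" for N \<omega>
    by (simp add: S_def power2_eq_square sum_product)
  have S2_int: "integrable M (\<lambda>\<omega>. (S N \<omega>)\<^sup>2)" for N
    unfolding S2 by (intro Bochner_Integration.integrable_sum a_int)
  have bound: "\<P>(\<omega> in M. \<delta> \<le> \<bar>(\<Sum>k<N. indicator (A k) \<omega>) / real N - q\<bar>)
      \<le> r / 4 + ((2 * real m + 1) / \<delta>\<^sup>2) / real N" if N: "N > 0" for N
  proof -
    have "\<P>(\<omega> in M. \<delta> \<le> \<bar>(\<Sum>k<N. indicator (A k) \<omega>) / real N - q\<bar>)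
        = \<P>(\<omega> in M. (\<delta> * real N)\<^sup>2 \<le> (S N \<omega>)\<^sup>2)"
    proof (intro arg_cong[where f=prob] Collect_cong conj_cong refl)
      fix \<omega>
      have "(\<Sum>k<N. indicator (A k) \<omega>) / real N - q = S N \<omega> / real N"
        using N by (simp add: S_def a_def sum_subtractf field_simps)
      then have "(\<delta> \<le> \<bar>(\<Sum>k<N. indicator (A k) \<omega>) / real N - q\<bar>) = (\<delta> * real N \<le> \<bar>S N \<omega>\<bar>)"
        using N by (simp add: field_simps)
      also have "\<dots> = ((\<delta> * real N)\<^sup>2 \<le> (S N \<omega>)\<^sup>2)"
        using \<delta> by (subst abs_le_square_iff[symmetric]) auto
      finally show "(\<delta> \<le> \<bar>(\<Sum>k<N. indicator (A k) \<omega>) / real N - q\<bar>) = ((\<delta> * real N)\<^sup>2 \<le> (S N \<omega>)\<^sup>2)" .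
    qed
    also have "\<dots> \<le> (\<integral>\<omega>. (S N \<omega>)\<^sup>2 \<partial>M) / (\<delta> * real N)\<^sup>2"
      by (rule integral_Markov_inequality_measure[where A="space M"])
        (use \<delta> N in \<open>simp_all add: S2_int\<close>)
    also have "(\<integral>\<omega>. (S N \<omega>)\<^sup>2 \<partial>M) = (\<Sum>k<N. \<Sum>l<N. \<integral>\<omega>. a k \<omega> * a l \<omega> \<partial>M)"
      unfolding S2 by (simp add: a_int)
    also have "\<dots> \<le> (\<Sum>k<N. real N * e + (2 * real m + 1))"
      by (intro sum_mono row)
    also have "\<dots> = real N * (real N * e + (2 * real m + 1))" by simp
    also have "\<dots> / (\<delta> * real N)\<^sup>2 = r / 4 + ((2 * real m + 1) / \<delta>\<^sup>2) / real N"
      using N \<delta> by (simp add: e_def field_simps power2_eq_square)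
    finally show ?thesis by (simp add: divide_right_mono)
  qed
  have "(\<lambda>N. r / 4 + ((2 * real m + 1) / \<delta>\<^sup>2) / real N) \<longlonglongrightarrow> r / 4 + 0"
    by (intro tendsto_add tendsto_const real_tendsto_divide_at_top[OF tendsto_const]
      filterlim_real_sequentially)
  then have "\<forall>\<^sub>F N in sequentially. r / 4 + ((2 * real m + 1) / \<delta>\<^sup>2) / real N < r"
    by (rule order_tendstoD) (use r in simp)
  then have "\<forall>\<^sub>F N in sequentially. norm (\<P>(\<omega> in M. \<delta> \<le> \<bar>(\<Sum>k<N. indicator (A k) \<omega>) / real N - q\<bar>) - 0) < r"
    using eventually_gt_at_top[of 0]
  proof eventually_elim
    case (elim N)
    have "0 \<le> \<P>(\<omega> in M. \<delta> \<le> \<bar>(\<Sum>k<N. indicator (A k) \<omega>) / real N - q\<bar>)" by simp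
    then show ?case unfolding real_norm_def using bound[OF elim(2)] elim(1) by linarith
  qed
  then show "\<exists>no. \<forall>n\<ge>no. norm (\<P>(\<omega> in M. \<delta> \<le> \<bar>(\<Sum>k<n. indicator (A k) \<omega>) / real n - q\<bar>) - 0) < r"
    by (simp add: eventually_sequentially)
qed

section \<open>Stationarity and mixing of functionals of an iid sequence\<close>

text \<open>The innovations are read backwards from time \<open>s\<close>. The index map from
  \<open>i\<close> to \<open>s - int i\<close> is injective, so it carries the product law on the
  integers to the product law on the naturals, whatever \<open>s\<close> is.\<close>

lemma (in prob_space) iid_shift_distr:
  fixes \<epsilon> :: "int \<Rightarrow> 'a \<Rightarrow> real"
  assumes rv: "\<And>s. \<epsilon> s \<in> borel_measurable M"
    and ind: "indep_vars (\<lambda>_. borel) \<epsilon> UNIV"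
    and id: "\<And>s. distr M borel (\<epsilon> s) = distr M borel (\<epsilon> 0)"
  shows "distr M (\<Pi>\<^sub>M i\<in>(UNIV::nat set). borel) (\<lambda>\<omega> i. \<epsilon> (s - int i) \<omega>) =
         (\<Pi>\<^sub>M i\<in>UNIV. distr M borel (\<epsilon> 0))"
proof -
  let ?D = "distr M borel (\<epsilon> 0)" and ?Z = "\<Pi>\<^sub>M i\<in>(UNIV::int set). (borel :: real measure)"
    and ?P = "\<Pi>\<^sub>M i\<in>(UNIV::nat set). (borel :: real measure)"
  have D: "prob_space ?D" by (rule prob_space_distr) (simp add: rv)
  have P: "sets (\<Pi>\<^sub>M i\<in>(UNIV::nat set). ?D) = sets ?P" by (intro sets_PiM_cong) auto
  have E: "distr M ?Z (\<lambda>\<omega> i. \<epsilon> i \<omega>) = (\<Pi>\<^sub>M i\<in>UNIV. ?D)"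
  proof -
    have "distr M ?Z (\<lambda>\<omega> i. \<epsilon> i \<omega>) = (\<Pi>\<^sub>M i\<in>UNIV. distr M borel (\<epsilon> i))"
      using ind rv indep_vars_iff_distr_eq_PiM[where I=UNIV and M'="\<lambda>_. borel" and X=\<epsilon>] by (simp add: restrict_def)
    also have "\<dots> = (\<Pi>\<^sub>M i\<in>UNIV. ?D)"
      by (rule arg_cong[where f="PiM UNIV"]) (rule ext, rule id)
    finally show ?thesis .
  qed
  have meas: "(\<lambda>\<omega> i. \<epsilon> i \<omega>) \<in> measurable M ?Z"
    by (intro measurable_PiM_single') (auto simp: rv)
  have shift: "(\<lambda>x n. x (s - int n)) \<in> measurable ?Z ?P"
    by (intro measurable_PiM_single') auto
  have "(\<Pi>\<^sub>M i\<in>(UNIV::nat set). ?D) =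
      distr (\<Pi>\<^sub>M i\<in>UNIV. ?D) (\<Pi>\<^sub>M i\<in>UNIV. ?D) (\<lambda>x. \<lambda>n\<in>UNIV. x (s - int n))"
    by (rule distr_PiM_reindex[symmetric, where f="\<lambda>n. s - int n"]) (auto simp: D inj_on_def)
  also have "\<dots> = distr (distr M ?Z (\<lambda>\<omega> i. \<epsilon> i \<omega>)) ?P (\<lambda>x n. x (s - int n))"
    unfolding E by (intro distr_cong) (auto simp: P)
  also have "\<dots> = distr M ?P (\<lambda>\<omega> i. \<epsilon> (s - int i) \<omega>)"
    by (subst distr_distr[OF shift meas]) (simp add: o_def)
  finally show ?thesis ..
qed

lemma (in prob_space) iid_shift_prob:
  fixes \<epsilon> :: "int \<Rightarrow> 'a \<Rightarrow> real"
  assumes rv: "\<And>s. \<epsilon> s \<in> borel_measurable M"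
    and ind: "indep_vars (\<lambda>_. borel) \<epsilon> UNIV"
    and id: "\<And>s. distr M borel (\<epsilon> s) = distr M borel (\<epsilon> 0)"
    and Q: "Measurable.pred (\<Pi>\<^sub>M i\<in>(UNIV::nat set). borel) Q"
  shows "\<P>(\<omega> in M. Q (\<lambda>i. \<epsilon> (s - int i) \<omega>)) = \<P>(\<omega> in M. Q (\<lambda>i. \<epsilon> (s' - int i) \<omega>))"
proof -
  let ?P = "\<Pi>\<^sub>M i\<in>(UNIV::nat set). (borel :: real measure)"
  have "\<P>(\<omega> in M. Q (\<lambda>i. \<epsilon> (r - int i) \<omega>)) =
      measure (\<Pi>\<^sub>M i\<in>(UNIV::nat set). distr M borel (\<epsilon> 0)) {x\<in>space ?P. Q x}" for r
  proof -
    have "(\<lambda>\<omega> i. \<epsilon> (r - int i) \<omega>) \<in> measurable M ?P"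
      by (intro measurable_PiM_single') (auto simp: rv)
    moreover have "{x\<in>space ?P. Q x} \<in> sets ?P" using Q by (rule predE)
    ultimately show ?thesis
      unfolding iid_shift_distr[OF rv ind id, of r, symmetric]
      by (subst measure_distr) (auto intro!: arg_cong[where f=prob] simp: space_PiM)
  qed
  then show ?thesis by simp
qed

text \<open>Only the later of the two values is truncated, to its last \<open>m\<close> innovations.
  It then shares no innovation with the earlier one, so the joint probability factorizes; the cost
  is the probability that truncation changes the event, which is the same at all times by
  stationarity.\<close>

lemma (in prob_space) bernoulli_shift_mixing:
  fixes \<epsilon> :: "int \<Rightarrow> 'a \<Rightarrow> real" and F :: "(nat \<Rightarrow> real) \<Rightarrow> real" and t :: int
  defines "X \<equiv> \<lambda>s \<omega> (i::nat). \<epsilon> (s - int i) \<omega>"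
  assumes rv: "\<And>s. \<epsilon> s \<in> borel_measurable M"
    and ind: "indep_vars (\<lambda>_. borel) \<epsilon> UNIV"
    and id: "\<And>s. distr M borel (\<epsilon> s) = distr M borel (\<epsilon> 0)"
    and F[measurable]: "F \<in> borel_measurable (\<Pi>\<^sub>M i\<in>UNIV. borel)"
    and trunc: "AE \<omega> in M. (\<lambda>g. F (\<lambda>i. if i < g then X t \<omega> i else 0)) \<longlonglongrightarrow> F (X t \<omega>)"
    and atom: "\<P>(\<omega> in M. F (X t \<omega>) = y) = 0"
    and e: "e > 0"
  shows "\<exists>m. \<forall>k l. k + m \<le> l \<longrightarrow>
     \<P>(\<omega> in M. F (X (t - int k) \<omega>) \<le> y \<and> F (X (t - int l) \<omega>) \<le> y)
       \<le> (\<P>(\<omega> in M. F (X t \<omega>) \<le> y))\<^sup>2 + e"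
proof -
  let ?P = "\<Pi>\<^sub>M i\<in>(UNIV::nat set). (borel :: real measure)"
  define T where "T g x = (\<lambda>i. if i < g then x i else 0)" for g :: nat and x :: "nat \<Rightarrow> real"
  have T[measurable]: "T g \<in> measurable ?P ?P" for g
    unfolding T_def by (intro measurable_PiM_single') auto
  have [measurable]: "X s \<in> measurable M ?P" for s
    unfolding X_def by (intro measurable_PiM_single') (auto simp: rv)
  define \<rho> where "\<rho> g = \<P>(\<omega> in M. (F (T g (X t \<omega>)) \<le> y) \<noteq> (F (X t \<omega>) \<le> y))" for g
  define q where "q = \<P>(\<omega> in M. F (X t \<omega>) \<le> y)"
  have "\<rho> \<longlonglongrightarrow> 0"
    unfolding \<rho>_def
  proof (rule prob_eventually_not_tendsto_0)
    \<comment> \<open>Off the boundary point \<open>y\<close>, convergence of the truncated values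
      forces them eventually onto the same side of \<open>y\<close> as the limit.\<close>
    have "AE \<omega> in M. F (X t \<omega>) \<noteq> y"
      using atom by (subst (asm) prob_eq_0) auto
    with trunc show "AE \<omega> in M. \<forall>\<^sub>F n in sequentially.
        \<omega> \<notin> {\<omega> \<in> space M. (F (T n (X t \<omega>)) \<le> y) \<noteq> (F (X t \<omega>) \<le> y)}"
    proof eventually_elim
      case (elim \<omega>)
      then have *: "(\<lambda>g. F (T g (X t \<omega>))) \<longlonglongrightarrow> F (X t \<omega>)" by (simp add: T_def)
      show ?case
      proof (cases "F (X t \<omega>) < y")
        case True
        from order_tendstoD(2)[OF * True] show ?thesis
          by eventually_elim (use True in auto)
      next
        case False
        with elim have "y < F (X t \<omega>)" by simp
        from order_tendstoD(1)[OF * this] show ?thesis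
          by eventually_elim (use \<open>y < F (X t \<omega>)\<close> in auto)
      qed
    qed
  qed measurable
  then have "\<forall>\<^sub>F g in sequentially. \<rho> g < e / 2"
    by (rule order_tendstoD) (use e in simp)
  \<comment> \<open>The number of retained innovations also serves as the separating gap. The bound
    e / 2 is chosen because the truncation error is paid twice below.\<close>
  then obtain m where m: "\<rho> m < e / 2"
    by (auto dest: eventually_happens)
  have \<rho>_shift: "\<P>(\<omega> in M. (F (T m (X s \<omega>)) \<le> y) \<noteq> (F (X s \<omega>) \<le> y)) = \<rho> m" for s
    unfolding \<rho>_def X_def
    by (rule iid_shift_prob[OF rv ind id, where Q="\<lambda>x. (F (T m x) \<le> y) \<noteq> (F x \<le> y)"]) measurable
  have q_shift: "\<P>(\<omega> in M. F (X s \<omega>) \<le> y) = q" for s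
    unfolding q_def X_def
    by (rule iid_shift_prob[OF rv ind id, where Q="\<lambda>x. F x \<le> y"]) measurable
  have indep: "\<P>(\<omega> in M. F (T m (X s \<omega>)) \<le> y \<and> F (X r \<omega>) \<le> y) =
      \<P>(\<omega> in M. F (T m (X s \<omega>)) \<le> y) * q" if "r \<le> s - int m" for r s
  proof -
    \<comment> \<open>These are the times that the truncated value at \<open>s\<close> and the full
      value at \<open>r\<close> depend on; they are disjoint because
      \<open>r \<le> s - int m\<close>.\<close>
    define A B where "A = {s - int m<..s}" and "B = {..r}"
    define f where "f x = F (\<lambda>i. if i < m then x (s - int i) else 0)" for x
    define g where "g x = F (\<lambda>i. x (r - int i))" for x
    have 1: "indep_var (PiM A (\<lambda>_. borel)) (\<lambda>\<omega>. restrict (\<lambda>i. \<epsilon> i \<omega>) A)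
      (PiM B (\<lambda>_. borel)) (\<lambda>\<omega>. restrict (\<lambda>i. \<epsilon> i \<omega>) B)"
      using that by (intro indep_var_restrict[OF ind]) (auto simp: A_def B_def)
    have f_meas: "f \<in> borel_measurable (PiM A (\<lambda>_. borel))"
    proof -
      have "(\<lambda>x (i::nat). if i < m then x (s - int i) else 0 :: real) \<in> measurable (PiM A (\<lambda>_. borel)) ?P"
      proof (intro measurable_PiM_single')
        fix i :: nat
        show "(\<lambda>x. if i < m then x (s - int i) else 0 :: real) \<in> borel_measurable (PiM A (\<lambda>_. borel))"
          by (cases "i < m") (auto intro!: measurable_component_singleton simp: A_def)
      qed auto
      from measurable_compose[OF this F] show ?thesis by (simp add: f_def[abs_def])
    qed
    have g_meas: "g \<in> borel_measurable (PiM B (\<lambda>_. borel))"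
    proof -
      have "(\<lambda>x (i::nat). x (r - int i) :: real) \<in> measurable (PiM B (\<lambda>_. borel)) ?P"
        by (intro measurable_PiM_single') (auto intro!: measurable_component_singleton simp: B_def)
      from measurable_compose[OF this F] show ?thesis by (simp add: g_def[abs_def])
    qed
    have fX: "f (restrict (\<lambda>i. \<epsilon> i \<omega>) A) = F (T m (X s \<omega>))" for \<omega>
      unfolding f_def T_def X_def
      by (intro arg_cong[where f=F]) (auto simp: fun_eq_iff A_def)
    have gX: "g (restrict (\<lambda>i. \<epsilon> i \<omega>) B) = F (X r \<omega>)" for \<omega>
      unfolding g_def X_def by (intro arg_cong[where f=F]) (auto simp: fun_eq_iff B_def)
    have 2: "indep_var borel (\<lambda>\<omega>. F (T m (X s \<omega>))) borel (\<lambda>\<omega>. F (X r \<omega>))"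
      using indep_var_compose[OF 1 f_meas g_meas] by (simp add: o_def fX gX)
    have "\<P>(\<omega> in M. F (T m (X s \<omega>)) \<le> y \<and> F (X r \<omega>) \<le> y) =
        \<P>(\<omega> in M. F (T m (X s \<omega>)) \<le> y) * \<P>(\<omega> in M. F (X r \<omega>) \<le> y)"
      using indep_varD[OF 2, of "{..y}" "{..y}"]
      by (simp add: vimage_def Int_def conj_commute conj_left_commute)
    then show ?thesis by (simp add: q_shift)
  qed
  show ?thesis
  proof (intro exI allI impI)
    fix k l assume "k + m \<le> l"
    define s r where "s = t - int k" and "r = t - int l"
    have rs: "r \<le> s - int m" using \<open>k + m \<le> l\<close> by (simp add: s_def r_def)
    have q0: "0 \<le> q" "q \<le> 1" and \<rho>0: "0 \<le> \<rho> m" unfolding q_def \<rho>_def by auto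
    \<comment> \<open>First payment of the truncation error, for the marginal of the truncated
      event; the second comes from replacing the event at \<open>s\<close> inside the joint
      probability.\<close>
    have "\<P>(\<omega> in M. F (T m (X s \<omega>)) \<le> y) \<le> q + \<rho> m"
      using prob_eq_diff_le[of "\<lambda>\<omega>. F (T m (X s \<omega>)) \<le> y" "\<lambda>\<omega>. F (X s \<omega>) \<le> y"]
      unfolding \<rho>_shift q_shift by (auto simp: abs_le_iff)
    then have "\<P>(\<omega> in M. F (T m (X s \<omega>)) \<le> y) * q \<le> (q + \<rho> m) * q"
      using q0 by (intro mult_right_mono) auto
    also have "\<dots> = q\<^sup>2 + q * \<rho> m" by (simp add: power2_eq_square algebra_simps)
    also have "\<dots> \<le> q\<^sup>2 + \<rho> m"
      using mult_right_mono[OF q0(2) \<rho>0] by simp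
    finally have 3: "\<P>(\<omega> in M. F (T m (X s \<omega>)) \<le> y \<and> F (X r \<omega>) \<le> y) \<le> q\<^sup>2 + \<rho> m"
      by (simp add: indep[OF rs])
    have "\<P>(\<omega> in M. F (X s \<omega>) \<le> y \<and> F (X r \<omega>) \<le> y) \<le>
      prob ({\<omega>\<in>space M. F (T m (X s \<omega>)) \<le> y \<and> F (X r \<omega>) \<le> y} \<union>
        {\<omega>\<in>space M. (F (T m (X s \<omega>)) \<le> y) \<noteq> (F (X s \<omega>) \<le> y)})"
      by (rule finite_measure_mono) auto
    also have "\<dots> \<le> \<P>(\<omega> in M. F (T m (X s \<omega>)) \<le> y \<and> F (X r \<omega>) \<le> y) + \<rho> m"
      unfolding \<rho>_shift[of s, symmetric] by (rule measure_Un_le) auto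
    finally show "\<P>(\<omega> in M. F (X (t - int k) \<omega>) \<le> y \<and> F (X (t - int l) \<omega>) \<le> y)
       \<le> (\<P>(\<omega> in M. F (X t \<omega>) \<le> y))\<^sup>2 + e"
      using 3 m by (simp add: s_def r_def q_def)
  qed
qed

subsection \<open>Consistency of the forecast coefficients\<close>

text \<open>The entries of a power of the companion matrix are polynomials in the coefficients. The
  filter is arbitrary because it is later instantiated on the coefficient vectors
  themselves.\<close>

lemma tendsto_phi_h:
  assumes lim: "\<And>i. i \<in> {1..d} \<Longrightarrow> ((\<lambda>x. \<psi> x i) \<longlongrightarrow> \<phi> i) F" and i: "i < d"
  shows "((\<lambda>x. phi_h d (\<psi> x) h i) \<longlongrightarrow> phi_h d \<phi> h i) F"
proof -
  have comp: "((\<lambda>x. companion d (\<psi> x) i j) \<longlongrightarrow> companion d \<phi> i j) F" if "i < d" for i j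
    using that lim[of "Suc i"] by (auto simp: companion_def)
  have "((\<lambda>x. mat_pow d (companion d (\<psi> x)) h i j) \<longlongrightarrow> mat_pow d (companion d \<phi>) h i j) F"
    if "i < d" for i j
    using that
  proof (induction h arbitrary: i)
    case (Suc h)
    then show ?case
      by (auto simp: mat_mul_def intro!: tendsto_sum tendsto_mult comp)
  qed simp
  then show ?thesis using i by (simp add: phi_h_def)
qed

lemma measurable_phi_h:
  assumes meas: "\<And>i. i \<in> {1..d} \<Longrightarrow> (\<lambda>\<omega>. \<psi> \<omega> i) \<in> borel_measurable M" and i: "i < d"
  shows "(\<lambda>\<omega>. phi_h d (\<psi> \<omega>) h i) \<in> borel_measurable M"
proof -
  have comp: "(\<lambda>\<omega>. companion d (\<psi> \<omega>) i j) \<in> borel_measurable M" if "i < d" for i j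
    using that meas[of "Suc i"] by (auto simp: companion_def)
  have "(\<lambda>\<omega>. mat_pow d (companion d (\<psi> \<omega>)) h i j) \<in> borel_measurable M"
    if "i < d" for i j
    using that
  proof (induction h arbitrary: i)
    case (Suc h)
    then show ?case
      by (auto simp: mat_mul_def intro!: borel_measurable_sum borel_measurable_times comp)
  qed simp
  then show ?thesis using i by (simp add: phi_h_def)
qed

text \<open>Continuous mapping for convergence in probability to a constant: continuity at the true
  coefficients supplies a radius, and a union bound over the coordinates controls the chance of
  leaving it.\<close>

lemma (in prob_space) phi_h_consistent:
  fixes \<phi>hat :: "nat \<Rightarrow> 'a \<Rightarrow> nat \<Rightarrow> real"
  assumes rv: "\<And>n i. i \<in> {1..d} \<Longrightarrow> (\<lambda>\<omega>. \<phi>hat n \<omega> i) \<in> borel_measurable M"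
    and cons: "\<And>i e. i \<in> {1..d} \<Longrightarrow> e > 0 \<Longrightarrow>
      (\<lambda>n. \<P>(\<omega> in M. \<bar>\<phi>hat n \<omega> i - \<phi> i\<bar> > e)) \<longlonglongrightarrow> 0"
    and \<eta>: "\<eta> > 0"
  shows "(\<lambda>n. \<P>(\<omega> in M. (\<Sum>i<d. \<bar>phi_h d (\<phi>hat n \<omega>) h i - phi_h d \<phi> h i\<bar>) > \<eta>)) \<longlonglongrightarrow> 0"
proof -
  define f where "f \<psi> = (\<Sum>i=1..d. \<bar>\<psi> i - \<phi> i\<bar>)" for \<psi> :: "nat \<Rightarrow> real"
  \<comment> \<open>Neighbourhoods of the true vector that see only the coordinates 1 to
    \<open>d\<close>. Unfolding this filter yields the radius \<open>\<delta>\<close> in terms of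
    \<open>f\<close>.\<close>
  define F where "F = filtercomap f (nhds 0)"
  have f: "(f \<longlongrightarrow> 0) F" unfolding F_def by (rule filterlim_filtercomap)
  have "((\<lambda>\<psi>. \<psi> i) \<longlongrightarrow> \<phi> i) F" if "i \<in> {1..d}" for i
  proof -
    have "norm (\<psi> i - \<phi> i) \<le> f \<psi>" for \<psi>
      unfolding f_def real_norm_def using that by (intro member_le_sum) auto
    then have "((\<lambda>\<psi>. \<psi> i - \<phi> i) \<longlongrightarrow> 0) F"
      by (intro Lim_null_comparison[OF _ f] always_eventually) auto
    then show ?thesis by (simp add: LIM_zero_iff)
  qed
  then have "((\<lambda>\<psi>. phi_h d \<psi> h i) \<longlongrightarrow> phi_h d \<phi> h i) F" if "i < d" for i
    using that by (intro tendsto_phi_h)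
  then have "((\<lambda>\<psi>. \<Sum>i<d. \<bar>phi_h d \<psi> h i - phi_h d \<phi> h i\<bar>) \<longlongrightarrow>
      (\<Sum>i<d. \<bar>phi_h d \<phi> h i - phi_h d \<phi> h i\<bar>)) F"
    by (intro tendsto_sum tendsto_rabs tendsto_diff tendsto_const) auto
  then have "\<forall>\<^sub>F \<psi> in F. (\<Sum>i<d. \<bar>phi_h d \<psi> h i - phi_h d \<phi> h i\<bar>) < \<eta>"
    by (rule order_tendstoD) (use \<eta> in simp)
  then obtain \<delta> where \<delta>: "\<delta> > 0"
    "\<And>\<psi>. f \<psi> < \<delta> \<Longrightarrow> (\<Sum>i<d. \<bar>phi_h d \<psi> h i - phi_h d \<phi> h i\<bar>) < \<eta>"
    unfolding F_def eventually_filtercomap eventually_nhds_metric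
    by (auto simp: dist_real_def) (metis abs_of_nonneg f_def sum_abs_ge_zero)
  \<comment> \<open>The sum of \<open>d\<close> deviations of size at most \<open>e\<close> stays
    strictly below \<open>\<delta>\<close>, also when \<open>d\<close> is 0.\<close>
  define e where "e = \<delta> / (real d + 1)"
  have e: "e > 0" using \<delta> by (simp add: e_def)
  have f_small: "f \<psi> < \<delta>" if "\<And>i. i \<in> {1..d} \<Longrightarrow> \<bar>\<psi> i - \<phi> i\<bar> \<le> e" for \<psi>
  proof -
    have "f \<psi> \<le> (\<Sum>i=1..d. e)" unfolding f_def using that by (intro sum_mono) auto
    also have "\<dots> < \<delta>" using \<delta> by (simp add: e_def field_simps)
    finally show ?thesis .
  qed
  show ?thesis
  proof (rule tendsto_sandwich[OF always_eventually _ tendsto_const])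
    show "(\<lambda>n. \<Sum>i=1..d. \<P>(\<omega> in M. \<bar>\<phi>hat n \<omega> i - \<phi> i\<bar> > e)) \<longlonglongrightarrow> 0"
      using tendsto_sum[of "{1..d}" "\<lambda>i n. \<P>(\<omega> in M. \<bar>\<phi>hat n \<omega> i - \<phi> i\<bar> > e)" "\<lambda>_. 0"] cons e by auto
    show "\<forall>\<^sub>F n in sequentially.
        \<P>(\<omega> in M. (\<Sum>i<d. \<bar>phi_h d (\<phi>hat n \<omega>) h i - phi_h d \<phi> h i\<bar>) > \<eta>)
        \<le> (\<Sum>i=1..d. \<P>(\<omega> in M. \<bar>\<phi>hat n \<omega> i - \<phi> i\<bar> > e))"
    proof (intro always_eventually allI)
      fix n
      have ev: "{\<omega>\<in>space M. \<bar>\<phi>hat n \<omega> i - \<phi> i\<bar> > e} \<in> events" if "i \<in> {1..d}" for i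
        using rv[OF that, of n] by measurable
      have "\<P>(\<omega> in M. (\<Sum>i<d. \<bar>phi_h d (\<phi>hat n \<omega>) h i - phi_h d \<phi> h i\<bar>) > \<eta>)
          \<le> prob (\<Union>i\<in>{1..d}. {\<omega>\<in>space M. \<bar>\<phi>hat n \<omega> i - \<phi> i\<bar> > e})"
      proof (rule finite_measure_mono)
        show "{\<omega> \<in> space M. \<eta> < (\<Sum>i<d. \<bar>phi_h d (\<phi>hat n \<omega>) h i - phi_h d \<phi> h i\<bar>)}
          \<subseteq> (\<Union>i\<in>{1..d}. {\<omega>\<in>space M. \<bar>\<phi>hat n \<omega> i - \<phi> i\<bar> > e})"
          using \<delta>(2) f_small by (fastforce simp: not_less)
      qed (use ev in auto)
      also have "\<dots> \<le> (\<Sum>i=1..d. \<P>(\<omega> in M. \<bar>\<phi>hat n \<omega> i - \<phi> i\<bar> > e))"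
        using ev by (intro finite_measure_subadditive_finite) auto
      finally show "\<P>(\<omega> in M. (\<Sum>i<d. \<bar>phi_h d (\<phi>hat n \<omega>) h i - phi_h d \<phi> h i\<bar>) > \<eta>)
        \<le> (\<Sum>i=1..d. \<P>(\<omega> in M. \<bar>\<phi>hat n \<omega> i - \<phi> i\<bar> > e))" .
    qed
  qed simp
qed

subsection \<open>Empirical ranks\<close>

lemma (in real_distribution) cdf_surj:
  assumes cont: "\<And>x. isCont (cdf M) x" and u: "0 < u" "u < 1"
  shows "\<exists>y. cdf M y = u"
proof -
  have "\<forall>\<^sub>F y in at_bot. cdf M y < u" "\<forall>\<^sub>F y in at_top. u < cdf M y"
    using u order_tendstoD(2)[OF cdf_lim_at_bot, of u] order_tendstoD(1)[OF cdf_lim_at_top_prob, of u]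
    by auto
  then obtain a b where a: "cdf M a < u" and b: "u < cdf M b"
    unfolding eventually_at_bot_linorder eventually_at_top_linorder by blast
  then have "a \<le> b" using cdf_nondecreasing[of b a] by linarith
  then show ?thesis
    using IVT[of "cdf M" a u b] a b cont by auto
qed

text \<open>By linearity the average of the indicators has mean \<open>q\<close>, and Markov's
  inequality applies. This controls the fraction of time points at which the lag vector is
  large.\<close>

lemma (in prob_space) average_probability_Markov:
  assumes A[measurable]: "\<And>k. A k \<in> events" and q: "\<And>k. prob (A k) = q"
    and N: "N > 0" and c: "c > 0"
  shows "\<P>(\<omega> in M. c \<le> (\<Sum>k<N. indicator (A k) \<omega>) / real N) \<le> q / c"
proof -
  have i: "integrable M (indicator (A k) :: 'a \<Rightarrow> real)" for k
    by (intro integrable_real_indicator) (auto simp: emeasure_eq_measure)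
  have "\<P>(\<omega> in M. c \<le> (\<Sum>k<N. indicator (A k) \<omega>) / real N)
      \<le> (\<integral>\<omega>. (\<Sum>k<N. indicator (A k) \<omega>) / real N \<partial>M) / c"
    by (rule integral_Markov_inequality_measure[where A="space M"])
      (auto intro!: sum_nonneg divide_nonneg_nonneg i c)
  also have "(\<integral>\<omega>. (\<Sum>k<N. indicator (A k) \<omega>) / real N \<partial>M) = q"
    using N by (simp add: i q)
  finally show ?thesis .
qed

text \<open>\<open>Z k\<close> plays the lag vector at time t - k and \<open>W k\<close> the oracle
  forecast there. Disagreement of the two rank events is covered by six exceptional events: forecast
  in the critical strip (\<open>B1\<close>), large current lag vector, too many large lag vectors
  (\<open>B2\<close>), failure of the weak law at either of two levels (\<open>B3\<close>),
  estimator far off (\<open>B4\<close>).\<close>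

lemma (in prob_space) empirical_rank_event_limit:
  fixes Z :: "nat \<Rightarrow> nat \<Rightarrow> 'a \<Rightarrow> real" and c :: "nat \<Rightarrow> real"
    and chat :: "nat \<Rightarrow> nat \<Rightarrow> 'a \<Rightarrow> real" and N :: "nat \<Rightarrow> nat" and d :: nat and W :: "nat \<Rightarrow> 'a \<Rightarrow> real"
  defines "W \<equiv> \<lambda>k \<omega>. \<Sum>i<d. c i * Z k i \<omega>"
  assumes Z[measurable]: "\<And>k i. Z k i \<in> borel_measurable M"
    and chat: "\<And>n i. i < d \<Longrightarrow> chat n i \<in> borel_measurable M"
    and tail: "\<And>k K. \<P>(\<omega> in M. (\<Sum>i<d. \<bar>Z k i \<omega>\<bar>) > K) = \<P>(\<omega> in M. (\<Sum>i<d. \<bar>Z 0 i \<omega>\<bar>) > K)"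
    and lln: "\<And>y \<delta>. \<delta> > 0 \<Longrightarrow> (\<lambda>N. \<P>(\<omega> in M. \<delta> \<le>
      \<bar>(\<Sum>k<N. indicator {\<omega>\<in>space M. W k \<omega> \<le> y} \<omega>) / real N - \<P>(\<omega> in M. W 0 \<omega> \<le> y)\<bar>)) \<longlonglongrightarrow> 0"
    and atomless: "\<And>y. \<P>(\<omega> in M. W 0 \<omega> = y) = 0"
    and cons: "\<And>\<eta>. \<eta> > 0 \<Longrightarrow> (\<lambda>n. \<P>(\<omega> in M. (\<Sum>i<d. \<bar>chat n i \<omega> - c i\<bar>) > \<eta>)) \<longlonglongrightarrow> 0"
    and N: "filterlim N at_top sequentially" and p: "0 < p" "p < 1"
  shows "(\<lambda>n. \<P>(\<omega> in M.
      (p \<le> (1 / real (N n)) * (\<Sum>k<N n. if (\<Sum>i<d. chat n i \<omega> * Z k i \<omega>) \<le> (\<Sum>i<d. chat n i \<omega> * Z 0 i \<omega>) then 1 else 0))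
      \<noteq> (p \<le> \<P>(\<omega>' in M. W 0 \<omega>' \<le> W 0 \<omega>)))) \<longlonglongrightarrow> 0"
    (is "(\<lambda>n. prob (?C n)) \<longlonglongrightarrow> 0")
proof (rule LIMSEQ_I)
  fix r :: real assume r: "r > 0"
  have W[measurable]: "W k \<in> borel_measurable M" for k unfolding W_def by measurable
  define D where "D = distr M borel (W 0)"
  interpret D: real_distribution D unfolding D_def by (rule real_distribution_distr) measurable
  define G where "G = cdf D"
  have G: "\<P>(\<omega> in M. W 0 \<omega> \<le> y) = G y" for y
    by (simp add: G_def cdf_def D_def measure_distr vimage_def Int_def conj_commute)
  have G_cont: "isCont G y" for y
    unfolding G_def D.isCont_cdf using atomless[of y]
    by (simp add: D_def measure_distr vimage_def Int_def conj_commute)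
  have G_mono: "G x \<le> G y" if "x \<le> y" for x y
    using that unfolding G_def by (rule D.cdf_nondecreasing)
  \<comment> \<open>The last two terms keep the levels \<open>p - \<alpha>\<close> and
    \<open>p + \<alpha>\<close> inside the open unit interval; the first makes the strip of mass at
    most \<open>3 * \<alpha>\<close> cost no more than 3 r / 8.\<close>
  define \<alpha> where "\<alpha> = min (r / 8) (min (p / 2) ((1 - p) / 2))"
  have \<alpha>: "\<alpha> > 0" "\<alpha> < p" "\<alpha> < 1 - p" "\<alpha> \<le> r / 8" using r p by (auto simp: \<alpha>_def min_def)
  obtain y1 where y1: "G y1 = p - \<alpha>"
    using D.cdf_surj[of "p - \<alpha>"] G_cont \<alpha> p unfolding G_def by auto
  obtain y2 where y2: "G y2 = p + \<alpha>"
    using D.cdf_surj[of "p + \<alpha>"] G_cont \<alpha> p unfolding G_def by auto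
  \<comment> \<open>The strip between \<open>y1\<close> and \<open>y2\<close> has mass
    \<open>2 * \<alpha>\<close>, so by continuity some margin \<open>\<kappa>\<close> on both sides
    keeps it below \<open>3 * \<alpha>\<close>.\<close>
  have "((\<lambda>\<kappa>. G (y2 + \<kappa>) - G (y1 - \<kappa>)) \<longlongrightarrow> G (y2 + 0) - G (y1 - 0)) (at_right 0)"
    by (intro tendsto_diff isCont_tendsto_compose[OF G_cont] tendsto_add tendsto_const tendsto_ident_at)
  then have "\<forall>\<^sub>F \<kappa> in at_right 0. G (y2 + \<kappa>) - G (y1 - \<kappa>) < 3 * \<alpha>"
    by (rule order_tendstoD) (use y1 y2 \<alpha> in simp)
  then have "\<forall>\<^sub>F \<kappa> in at_right 0. G (y2 + \<kappa>) - G (y1 - \<kappa>) < 3 * \<alpha> \<and> \<kappa> > 0"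
    using eventually_at_right_less[of 0] by eventually_elim auto
  then obtain \<kappa> where \<kappa>: "\<kappa> > 0" "G (y2 + \<kappa>) - G (y1 - \<kappa>) < 3 * \<alpha>"
    by (metis (mono_tags, lifting) eventually_happens trivial_limit_at_right_real)
  define nZ where "nZ k \<omega> = (\<Sum>i<d. \<bar>Z k i \<omega>\<bar>)" for k \<omega>
  have [measurable]: "nZ k \<in> borel_measurable M" for k unfolding nZ_def by measurable
  define H where "H k K = {\<omega>\<in>space M. nZ k \<omega> > K}" for k and K :: real
  have [measurable]: "H k K \<in> events" for k K unfolding H_def by measurable
  have "(\<lambda>n. prob (H 0 (real n))) \<longlonglongrightarrow> 0"
  proof (rule prob_eventually_not_tendsto_0)
    have "\<forall>\<^sub>F n in sequentially. \<omega> \<notin> H 0 (real n)" for \<omega>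
      using eventually_ge_at_top[of "nat \<lceil>nZ 0 \<omega>\<rceil>"]
      by eventually_elim (simp add: H_def not_less nat_le_iff ceiling_le_iff)
    then show "AE \<omega> in M. \<forall>\<^sub>F n in sequentially. \<omega> \<notin> H 0 (real n)" by simp
  qed measurable
  \<comment> \<open>The first bound is for the current lag vector; the second becomes r / 8 when
    Markov's inequality divides it by \<open>\<alpha> / 2\<close>.\<close>
  then have "\<forall>\<^sub>F n in sequentially. prob (H 0 (real n)) < min (r / 16) (\<alpha> * r / 16)"
    by (rule order_tendstoD) (use \<alpha> r in simp)
  then have "\<forall>\<^sub>F n in sequentially. prob (H 0 (real n)) < min (r / 16) (\<alpha> * r / 16) \<and> n > 0"
    using eventually_gt_at_top[of 0] by eventually_elim auto
  then obtain n0 :: nat where n0: "n0 > 0" "prob (H 0 (real n0)) < min (r / 16) (\<alpha> * r / 16)"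
    by (auto dest: eventually_happens)
  define K where "K = real n0"
  have K: "K > 0" "prob (H 0 K) < r / 16" "prob (H 0 K) < \<alpha> * r / 16"
    using n0 by (auto simp: K_def)
  have HK: "prob (H k K) = prob (H 0 K)" for k using tail[of K k] by (simp add: H_def nZ_def)
  \<comment> \<open>With lag vectors bounded by \<open>K\<close>, each estimated forecast is then
    within \<open>\<kappa> / 2\<close> of its oracle value, so comparing two forecasts loses at most
    \<open>\<kappa>\<close>.\<close>
  define \<eta> where "\<eta> = \<kappa> / (2 * K)"
  have \<eta>: "\<eta> > 0" using \<kappa> K by (simp add: \<eta>_def)
  define T where "T m \<omega> = (\<Sum>k<m. indicator (H k K) \<omega>) / real m" for m \<omega>
  define Gm where "Gm y m \<omega> = (\<Sum>k<m. indicator {\<omega>\<in>space M. W k \<omega> \<le> y} \<omega>) / real m" for y m \<omega>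
  define Dn where "Dn n \<omega> = (\<Sum>i<d. \<bar>chat n i \<omega> - c i\<bar>)" for n \<omega>
  have [measurable]: "T m \<in> borel_measurable M" "Gm y m \<in> borel_measurable M" for m y
    unfolding T_def[abs_def] Gm_def[abs_def] by measurable
  have [measurable]: "Dn n \<in> borel_measurable M" for n
    unfolding Dn_def[abs_def]
    by (intro borel_measurable_sum borel_measurable_abs borel_measurable_diff chat) auto
  define B1 where "B1 = {\<omega>\<in>space M. y1 - \<kappa> < W 0 \<omega> \<and> W 0 \<omega> \<le> y2 + \<kappa>}"
  define B2 where "B2 m = {\<omega>\<in>space M. \<alpha> / 2 \<le> T m \<omega>}" for m
  define B3 where "B3 y m = {\<omega>\<in>space M. \<alpha> / 2 \<le> \<bar>Gm y m \<omega> - G y\<bar>}" for y m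
  define B4 where "B4 n = {\<omega>\<in>space M. Dn n \<omega> > \<eta>}" for n
  have [measurable]: "B1 \<in> events" "B2 m \<in> events" "B3 y m \<in> events" "B4 n \<in> events" for y m n
    unfolding B1_def B2_def B3_def B4_def by measurable
  have B1: "prob B1 \<le> 3 * r / 8"
  proof -
    have "y1 - \<kappa> < y2 + \<kappa>" using \<kappa> y1 y2 \<alpha> G_mono[of y2 y1] by linarith
    then have "prob B1 = G (y2 + \<kappa>) - G (y1 - \<kappa>)"
      unfolding G_def by (subst D.cdf_diff_eq)
        (auto simp: B1_def D_def measure_distr vimage_def Int_def intro!: arg_cong[where f=prob])
    then show ?thesis using \<kappa> \<alpha> by linarith
  qed
  have B2: "prob (B2 m) \<le> r / 8" if "m > 0" for m
  proof -
    have "prob (B2 m) \<le> prob (H 0 K) / (\<alpha> / 2)"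
      unfolding B2_def T_def by (rule average_probability_Markov) (use HK that \<alpha> in auto)
    also have "\<dots> \<le> r / 8" using K \<alpha> by (simp add: field_simps)
    finally show ?thesis .
  qed
  have B3: "(\<lambda>n. prob (B3 y (N n))) \<longlonglongrightarrow> 0" for y
    unfolding B3_def Gm_def G[symmetric]
    by (rule filterlim_compose[OF lln N]) (use \<alpha> in auto)
  have B4: "(\<lambda>n. prob (B4 n)) \<longlonglongrightarrow> 0"
    unfolding B4_def Dn_def by (rule cons[OF \<eta>])
  have incl: "?C n \<subseteq> B1 \<union> H 0 K \<union> B2 (N n) \<union> B3 y1 (N n) \<union> B3 y2 (N n) \<union> B4 n" if "N n > 0" for n
  proof (rule subsetI, rule ccontr)
    fix \<omega> assume \<omega>: "\<omega> \<in> ?C n"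
      and "\<omega> \<notin> B1 \<union> H 0 K \<union> B2 (N n) \<union> B3 y1 (N n) \<union> B3 y2 (N n) \<union> B4 n"
    moreover from \<omega> have sp: "\<omega> \<in> space M" by simp
    ultimately have b1: "W 0 \<omega> \<le> y1 - \<kappa> \<or> y2 + \<kappa> < W 0 \<omega>" and b0: "nZ 0 \<omega> \<le> K"
      and b2: "T (N n) \<omega> < \<alpha> / 2" and b3: "\<bar>Gm y1 (N n) \<omega> - G y1\<bar> < \<alpha> / 2" "\<bar>Gm y2 (N n) \<omega> - G y2\<bar> < \<alpha> / 2"
      and b4: "Dn n \<omega> \<le> \<eta>"
      by (auto simp: B1_def B2_def B3_def B4_def H_def not_less not_le)
    define V where "V k = (\<Sum>i<d. chat n i \<omega> * Z k i \<omega>)" for k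
    have VW: "\<bar>V k - W k \<omega>\<bar> \<le> \<kappa> / 2" if "nZ k \<omega> \<le> K" for k
    proof -
      have "\<bar>V k - W k \<omega>\<bar> = \<bar>\<Sum>i<d. (chat n i \<omega> - c i) * Z k i \<omega>\<bar>"
        by (simp add: V_def W_def sum_subtractf left_diff_distrib)
      also have "\<dots> \<le> (\<Sum>i<d. \<bar>chat n i \<omega> - c i\<bar> * \<bar>Z k i \<omega>\<bar>)"
        by (rule order_trans[OF sum_abs]) (simp add: abs_mult)
      also have "\<dots> \<le> (\<Sum>i<d. Dn n \<omega> * \<bar>Z k i \<omega>\<bar>)"
        unfolding Dn_def by (intro sum_mono mult_right_mono member_le_sum) auto
      also have "\<dots> = Dn n \<omega> * nZ k \<omega>" by (simp add: nZ_def sum_distrib_left)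
      also have "\<dots> \<le> \<eta> * K"
        using b4 that \<eta> by (intro mult_mono) (auto simp: nZ_def intro!: sum_nonneg)
      also have "\<dots> = \<kappa> / 2" using K by (simp add: \<eta>_def)
      finally show ?thesis .
    qed
    define U where "U = (1 / real (N n)) * (\<Sum>k<N n. if V k \<le> V 0 then 1 else 0)"
    have C: "(p \<le> U) \<noteq> (p \<le> G (W 0 \<omega>))"
      using \<omega> by (simp add: U_def V_def G)
    from b1 show False
    proof
      \<comment> \<open>Each index counted by the empirical rank has
        \<open>W k \<omega> \<le> y1\<close> or a large lag vector. Hence the rank is below (p -
        \<open>\<alpha>\<close>) + \<open>\<alpha> / 2\<close> + \<open>\<alpha> / 2\<close> = p,
        and so is the oracle rank.\<close>
      assume lo: "W 0 \<omega> \<le> y1 - \<kappa>"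
      have step: "nZ k \<omega> \<le> K \<Longrightarrow> V k \<le> V 0 \<Longrightarrow> W k \<omega> \<le> y1" for k
        using VW[of k] VW[OF b0] lo by linarith
      have "(if V k \<le> V 0 then 1 else 0) \<le>
          (indicator {\<omega>\<in>space M. W k \<omega> \<le> y1} \<omega> + indicator (H k K) \<omega> :: real)" for k
        using step[of k] sp by (auto simp: H_def indicator_def)
      then have "U \<le> (1 / real (N n)) * (\<Sum>k<N n. indicator {\<omega>\<in>space M. W k \<omega> \<le> y1} \<omega> + indicator (H k K) \<omega>)"
        unfolding U_def by (intro mult_left_mono sum_mono) auto
      also have "\<dots> = Gm y1 (N n) \<omega> + T (N n) \<omega>"
        by (simp add: Gm_def T_def sum.distrib add_divide_distrib)
      finally have "U < p" using b2 b3 y1 by linarith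
      moreover have "G (W 0 \<omega>) < p" using G_mono[of "W 0 \<omega>" y1] lo \<kappa> y1 \<alpha> by linarith
      ultimately show False using C by auto
    next
      \<comment> \<open>Mirror image: every index with \<open>W k \<omega> \<le> y2\<close> and a
        moderate lag vector is counted, which pushes both ranks up to at least
        \<open>p\<close>.\<close>
      assume hi: "y2 + \<kappa> < W 0 \<omega>"
      have step: "nZ k \<omega> \<le> K \<Longrightarrow> W k \<omega> \<le> y2 \<Longrightarrow> V k \<le> V 0" for k
        using VW[of k] VW[OF b0] hi by linarith
      have "(indicator {\<omega>\<in>space M. W k \<omega> \<le> y2} \<omega> - indicator (H k K) \<omega> :: real) \<le>
          (if V k \<le> V 0 then 1 else 0)" for k
        using step[of k] sp by (auto simp: H_def indicator_def)
      then have "(1 / real (N n)) * (\<Sum>k<N n. indicator {\<omega>\<in>space M. W k \<omega> \<le> y2} \<omega> - indicator (H k K) \<omega>) \<le> U"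
        unfolding U_def by (intro mult_left_mono sum_mono) auto
      also have "(1 / real (N n)) * (\<Sum>k<N n. indicator {\<omega>\<in>space M. W k \<omega> \<le> y2} \<omega> - indicator (H k K) \<omega>)
        = Gm y2 (N n) \<omega> - T (N n) \<omega>"
        by (simp add: Gm_def T_def sum_subtractf diff_divide_distrib)
      finally have "p \<le> U" using b2 b3 y2 by linarith
      moreover have "p \<le> G (W 0 \<omega>)" using G_mono[of y2 "W 0 \<omega>"] hi \<kappa> y2 \<alpha> by linarith
      ultimately show False using C by auto
    qed
  qed
  have "\<forall>\<^sub>F n in sequentially. N n > 0"
    using N eventually_gt_at_top[of 0] unfolding filterlim_iff by blast
  moreover have "\<forall>\<^sub>F n in sequentially. prob (B3 y1 (N n)) < r / 16"
    by (rule order_tendstoD[OF B3]) (use r in simp)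
  moreover have "\<forall>\<^sub>F n in sequentially. prob (B3 y2 (N n)) < r / 16"
    by (rule order_tendstoD[OF B3]) (use r in simp)
  moreover have "\<forall>\<^sub>F n in sequentially. prob (B4 n) < r / 16"
    by (rule order_tendstoD[OF B4]) (use r in simp)
  ultimately have "\<forall>\<^sub>F n in sequentially. norm (prob (?C n) - 0) < r"
  proof eventually_elim
    case (elim n)
    have "prob (?C n) \<le> prob (B1 \<union> H 0 K \<union> B2 (N n) \<union> B3 y1 (N n) \<union> B3 y2 (N n) \<union> B4 n)"
      by (rule finite_measure_mono[OF incl[OF elim(1)]]) measurable
    also have "\<dots> \<le> prob (B1 \<union> H 0 K \<union> B2 (N n) \<union> B3 y1 (N n) \<union> B3 y2 (N n)) + prob (B4 n)"
      by (rule measure_Un_le) auto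
    also have "prob (B1 \<union> H 0 K \<union> B2 (N n) \<union> B3 y1 (N n) \<union> B3 y2 (N n)) \<le>
        prob (B1 \<union> H 0 K \<union> B2 (N n) \<union> B3 y1 (N n)) + prob (B3 y2 (N n))"
      by (rule measure_Un_le) auto
    also have "prob (B1 \<union> H 0 K \<union> B2 (N n) \<union> B3 y1 (N n)) \<le>
        prob (B1 \<union> H 0 K \<union> B2 (N n)) + prob (B3 y1 (N n))"
      by (rule measure_Un_le) auto
    also have "prob (B1 \<union> H 0 K \<union> B2 (N n)) \<le> prob (B1 \<union> H 0 K) + prob (B2 (N n))"
      by (rule measure_Un_le) auto
    also have "prob (B1 \<union> H 0 K) \<le> prob B1 + prob (H 0 K)"
      by (rule measure_Un_le) auto
    finally have "prob (?C n) < r" using elim B1 B2[OF elim(1)] K r by linarith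
    then show ?case by simp
  qed
  then show "\<exists>no. \<forall>n\<ge>no. norm (prob (?C n) - 0) < r"
    by (simp add: eventually_sequentially)
qed

subsection \<open>Causal moving averages\<close>

text \<open>When \<open>x\<close> lists the innovations backwards from time s, entry
  \<open>i\<close> is the moving average at time s - i. Acting on whole sequences makes the entire
  past of the process a functional of one innovation path.\<close>

definition ma_filter :: "(nat \<Rightarrow> real) \<Rightarrow> (nat \<Rightarrow> real) \<Rightarrow> nat \<Rightarrow> real" where
  "ma_filter a x = (\<lambda>i. \<Sum>j. a j * x (i + j))"

lemma measurable_ma_filter[measurable]:
  "ma_filter a \<in> measurable (\<Pi>\<^sub>M i\<in>UNIV. borel) (\<Pi>\<^sub>M i\<in>UNIV. borel)"
  unfolding ma_filter_def
  by (intro measurable_PiM_single' borel_measurable_suminf borel_measurable_times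
      borel_measurable_const measurable_component_singleton) auto

lemma ma_filter_truncation_tendsto:
  assumes "summable (\<lambda>j. a j * x (i + j))"
  shows "(\<lambda>g. ma_filter a (\<lambda>i. if i < g then x i else 0) i) \<longlonglongrightarrow> ma_filter a x i"
proof -
  \<comment> \<open>Truncating the innovations cuts the series to a partial sum; natural subtraction
    makes it empty when \<open>g\<close> is at most \<open>i\<close>.\<close>
  have "ma_filter a (\<lambda>i. if i < g then x i else 0) i = (\<Sum>j<g - i. a j * x (i + j))" for g
    unfolding ma_filter_def by (subst suminf_finite[of "{..<g - i}"]) (auto intro!: sum.cong)
  moreover have "(\<lambda>g. \<Sum>j<g - i. a j * x (i + j)) \<longlonglongrightarrow> ma_filter a x i"
    unfolding ma_filter_def
    by (rule filterlim_compose[OF summable_LIMSEQ[OF assms] filterlim_minus_const_nat_at_top])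
  ultimately show ?thesis by simp
qed

text \<open>The lags are countable, so one null set serves them all.\<close>

lemma (in prob_space) causal_ma_filter:
  fixes \<epsilon> Y :: "int \<Rightarrow> 'a \<Rightarrow> real"
  assumes "\<And>s. AE \<omega> in M. (\<lambda>i. a i * \<epsilon> (s - int i) \<omega>) sums Y s \<omega>"
  shows "AE \<omega> in M. \<forall>i. summable (\<lambda>j. a j * \<epsilon> (s - int (i + j)) \<omega>) \<and>
    Y (s - int i) \<omega> = ma_filter a (\<lambda>j. \<epsilon> (s - int j) \<omega>) i"
proof -
  have "AE \<omega> in M. \<forall>i. (\<lambda>j. a j * \<epsilon> (s - int i - int j) \<omega>) sums Y (s - int i) \<omega>"
    using assms by (simp add: AE_all_countable)
  then show ?thesis
  proof eventually_elim
    case (elim \<omega>)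
    have "s - int (i + j) = s - int i - int j" for i j by simp
    then show ?case
      using elim unfolding ma_filter_def by (simp only: sums_iff) metis
  qed
qed

text \<open>Almost surely the backward path of the process is the filtered backward innovation path,
  whose law is the same at every time.\<close>

lemma (in prob_space) causal_process_stationary:
  fixes \<epsilon> Y :: "int \<Rightarrow> 'a \<Rightarrow> real"
  assumes rv: "\<And>s. \<epsilon> s \<in> borel_measurable M"
    and ind: "indep_vars (\<lambda>_. borel) \<epsilon> UNIV"
    and id: "\<And>s. distr M borel (\<epsilon> s) = distr M borel (\<epsilon> 0)"
    and Y[measurable]: "\<And>s. Y s \<in> borel_measurable M"
    and ma: "\<And>s. AE \<omega> in M. (\<lambda>i. a i * \<epsilon> (s - int i) \<omega>) sums Y s \<omega>"
    and Q[measurable]: "Measurable.pred (\<Pi>\<^sub>M i\<in>(UNIV::nat set). borel) Q"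
  shows "\<P>(\<omega> in M. Q (\<lambda>i. Y (s - int i) \<omega>)) = \<P>(\<omega> in M. Q (\<lambda>i. Y (s' - int i) \<omega>))"
proof -
  have "\<P>(\<omega> in M. Q (\<lambda>i. Y (r - int i) \<omega>)) = \<P>(\<omega> in M. Q (ma_filter a (\<lambda>i. \<epsilon> (r - int i) \<omega>)))" for r
  proof (rule prob_eq_AE)
    show "AE \<omega> in M. Q (\<lambda>i. Y (r - int i) \<omega>) = Q (ma_filter a (\<lambda>i. \<epsilon> (r - int i) \<omega>))"
      using causal_ma_filter[where a=a and \<epsilon>=\<epsilon> and Y=Y, OF ma, of r]
      by eventually_elim simp
    have [measurable]: "(\<lambda>\<omega> i. Y (r - int i) \<omega>) \<in> measurable M (\<Pi>\<^sub>M i\<in>UNIV. borel)"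
      by (intro measurable_PiM_single') auto
    have [measurable]: "(\<lambda>\<omega> i. \<epsilon> (r - int i) \<omega>) \<in> measurable M (\<Pi>\<^sub>M i\<in>UNIV. borel)"
      by (intro measurable_PiM_single') (auto simp: rv)
    show "{\<omega> \<in> space M. Q (\<lambda>i. Y (r - int i) \<omega>)} \<in> events"
      "{\<omega> \<in> space M. Q (ma_filter a (\<lambda>i. \<epsilon> (r - int i) \<omega>))} \<in> events"
      by measurable
  qed
  moreover have "\<P>(\<omega> in M. Q (ma_filter a (\<lambda>i. \<epsilon> (s - int i) \<omega>))) =
      \<P>(\<omega> in M. Q (ma_filter a (\<lambda>i. \<epsilon> (s' - int i) \<omega>)))"
    by (rule iid_shift_prob[OF rv ind id, where Q="\<lambda>x. Q (ma_filter a x)"]) measurable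
  ultimately show ?thesis by simp
qed

text \<open>The linear forecast is almost surely a measurable functional of the innovations, and its
  truncations converge because each series does. Mixing and the weak law for events then
  combine.\<close>

lemma (in prob_space) causal_process_weak_law:
  fixes \<epsilon> Y :: "int \<Rightarrow> 'a \<Rightarrow> real" and c :: "nat \<Rightarrow> real" and d :: nat
    and W :: "int \<Rightarrow> 'a \<Rightarrow> real"
  defines "W \<equiv> \<lambda>s \<omega>. \<Sum>i<d. c i * Y (s - int i) \<omega>"
  assumes rv: "\<And>s. \<epsilon> s \<in> borel_measurable M"
    and ind: "indep_vars (\<lambda>_. borel) \<epsilon> UNIV"
    and id: "\<And>s. distr M borel (\<epsilon> s) = distr M borel (\<epsilon> 0)"
    and Y[measurable]: "\<And>s. Y s \<in> borel_measurable M"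
    and ma: "\<And>s. AE \<omega> in M. (\<lambda>i. a i * \<epsilon> (s - int i) \<omega>) sums Y s \<omega>"
    and atom: "\<P>(\<omega> in M. W t \<omega> = y) = 0" and \<delta>: "\<delta> > 0"
  shows "(\<lambda>N. \<P>(\<omega> in M. \<delta> \<le> \<bar>(\<Sum>k<N. indicator {\<omega>\<in>space M. W (t - int k) \<omega> \<le> y} \<omega>) / real N
    - \<P>(\<omega> in M. W t \<omega> \<le> y)\<bar>)) \<longlonglongrightarrow> 0"
proof (rule weak_law_mixing_events[OF _ _ _ \<delta>])
  have W[measurable]: "W s \<in> borel_measurable M" for s unfolding W_def by measurable
  show "{\<omega>\<in>space M. W (t - int k) \<omega> \<le> y} \<in> events" for k by measurable
  have comp: "(\<lambda>x. x i) \<in> borel_measurable (\<Pi>\<^sub>M i\<in>(UNIV::nat set). (borel :: real measure))" for i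
    by (rule measurable_component_singleton) simp
  have pred: "Measurable.pred (\<Pi>\<^sub>M i\<in>(UNIV::nat set). (borel :: real measure)) (\<lambda>x. (\<Sum>i<d. c i * x i) \<le> y)"
    using comp by measurable
  show "\<P>(\<omega> in M. W (t - int k) \<omega> \<le> y) = \<P>(\<omega> in M. W t \<omega> \<le> y)" for k
    unfolding W_def by (rule causal_process_stationary[OF rv ind id Y ma pred])
  define F where "F x = (\<Sum>i<d. c i * ma_filter a x i)" for x
  have F: "F \<in> borel_measurable (\<Pi>\<^sub>M i\<in>UNIV. borel)"
    unfolding F_def[abs_def]
    by (intro borel_measurable_sum borel_measurable_times borel_measurable_const
        measurable_compose[OF measurable_ma_filter comp])
  note ma' = causal_ma_filter[where a=a and \<epsilon>=\<epsilon> and Y=Y, OF ma]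
  have WF: "AE \<omega> in M. W s \<omega> = F (\<lambda>i. \<epsilon> (s - int i) \<omega>)" for s
    using ma'[of s] by eventually_elim (simp add: W_def F_def)
  have trunc: "AE \<omega> in M. (\<lambda>g. F (\<lambda>i. if i < g then \<epsilon> (t - int i) \<omega> else 0)) \<longlonglongrightarrow> F (\<lambda>i. \<epsilon> (t - int i) \<omega>)"
    using ma'[of t]
  proof eventually_elim
    case (elim \<omega>)
    then show ?case unfolding F_def
      by (intro tendsto_sum tendsto_mult tendsto_const ma_filter_truncation_tendsto) auto
  qed
  have X[measurable]: "(\<lambda>\<omega> i. \<epsilon> (s - int i) \<omega>) \<in> measurable M (\<Pi>\<^sub>M i\<in>UNIV. borel)" for s
    by (intro measurable_PiM_single') (auto simp: rv)
  have FX[measurable]: "(\<lambda>\<omega>. F (\<lambda>i. \<epsilon> (s - int i) \<omega>)) \<in> borel_measurable M" for s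
    by (rule measurable_compose[OF X F])
  have eqs: "\<P>(\<omega> in M. F (\<lambda>i. \<epsilon> (t - int i) \<omega>) = y) = \<P>(\<omega> in M. W t \<omega> = y)"
    "\<P>(\<omega> in M. F (\<lambda>i. \<epsilon> (t - int i) \<omega>) \<le> y) = \<P>(\<omega> in M. W t \<omega> \<le> y)"
    using WF[of t] by (auto intro!: prob_eq_AE)
  have eqs2: "\<P>(\<omega> in M. F (\<lambda>i. \<epsilon> (t - int k - int i) \<omega>) \<le> y \<and> F (\<lambda>i. \<epsilon> (t - int l - int i) \<omega>) \<le> y) =
      \<P>(\<omega> in M. W (t - int k) \<omega> \<le> y \<and> W (t - int l) \<omega> \<le> y)" for k l
    using WF[of "t - int k"] WF[of "t - int l"] by (intro prob_eq_AE) (auto elim!: eventually_elim2)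
  have int_eq: "{\<omega>\<in>space M. P \<omega>} \<inter> {\<omega>\<in>space M. Q \<omega>} = {\<omega>\<in>space M. P \<omega> \<and> Q \<omega>}" for P Q by auto
  show "\<exists>m. \<forall>k l. k + m \<le> l \<longrightarrow> prob ({\<omega>\<in>space M. W (t - int k) \<omega> \<le> y} \<inter> {\<omega>\<in>space M. W (t - int l) \<omega> \<le> y})
      \<le> (\<P>(\<omega> in M. W t \<omega> \<le> y))\<^sup>2 + e" if "e > 0" for e
    using bernoulli_shift_mixing[OF rv ind id F trunc _ that, of y] atom
    unfolding int_eq eqs eqs2 by blast
qed

lemma (in prob_space) tendsto_prob_of_diff:
  assumes [measurable]: "Measurable.pred M P" "\<And>n. Measurable.pred M (Q n)"
    and diff: "(\<lambda>n. \<P>(\<omega> in M. Q n \<omega> \<noteq> P \<omega>)) \<longlonglongrightarrow> 0"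
  shows "(\<lambda>n. \<P>(\<omega> in M. Q n \<omega>)) \<longlonglongrightarrow> \<P>(\<omega> in M. P \<omega>)"
proof -
  have "norm (\<P>(\<omega> in M. Q n \<omega>) - \<P>(\<omega> in M. P \<omega>)) \<le> \<P>(\<omega> in M. Q n \<omega> \<noteq> P \<omega>)" for n
    unfolding real_norm_def by (rule prob_eq_diff_le) measurable
  then have "(\<lambda>n. \<P>(\<omega> in M. Q n \<omega>) - \<P>(\<omega> in M. P \<omega>)) \<longlonglongrightarrow> 0"
    by (intro Lim_null_comparison[OF always_eventually diff]) auto
  then show ?thesis by (rule LIM_zero_cancel)
qed

subsection \<open>Quantiles\<close>

text \<open>The distribution function may have flat pieces, so it is not inverted; monotonicity and
  points attaining given levels bound the probability from both sides.\<close>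

lemma (in prob_space) probability_integral_transform:
  fixes X :: "'a \<Rightarrow> real" and u :: real
  assumes X[measurable]: "X \<in> borel_measurable M"
    and atomless: "\<And>y. \<P>(\<omega> in M. X \<omega> = y) = 0" and u: "0 < u" "u < 1"
  shows "\<P>(\<omega> in M. u \<le> \<P>(\<omega>' in M. X \<omega>' \<le> X \<omega>)) = 1 - u"
proof -
  interpret D: real_distribution "distr M borel X" by (rule real_distribution_distr) simp
  define G where "G = cdf (distr M borel X)"
  have G: "\<P>(\<omega> in M. X \<omega> \<le> y) = G y" for y
    by (simp add: G_def cdf_def measure_distr vimage_def Int_def conj_commute)
  have cont: "isCont G y" for y
    unfolding G_def D.isCont_cdf using atomless[of y]
    by (simp add: measure_distr vimage_def Int_def conj_commute)
  have mono: "G x \<le> G y" if "x \<le> y" for x y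
    using that unfolding G_def by (rule D.cdf_nondecreasing)
  have level: "\<exists>y. G y = v" if "0 < v" "v < 1" for v
    using D.cdf_surj[OF cont[unfolded G_def] that] by (simp add: G_def)
  have "G \<in> borel_measurable borel" by (intro borel_measurable_mono monoI mono)
  then have [measurable]: "(\<lambda>\<omega>. G (X \<omega>)) \<in> borel_measurable M"
    by (rule measurable_compose[OF X])
  have upper: "\<P>(\<omega> in M. G (X \<omega>) < u) \<le> u"
  proof -
    obtain y where y: "G y = u" using level u by blast
    have "\<P>(\<omega> in M. G (X \<omega>) < u) \<le> \<P>(\<omega> in M. X \<omega> \<le> y)"
      using mono[of y] y by (intro finite_measure_mono) (auto simp: not_less, meson linear not_less)
    then show ?thesis by (simp add: G y)
  qed
  \<comment> \<open>A level strictly below \<open>u\<close> is used so that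
    \<open>X \<omega> \<le> y\<close> gives the strict inequality; letting \<open>v\<close> increase
    to \<open>u\<close> closes the gap.\<close>
  have lower: "v \<le> \<P>(\<omega> in M. G (X \<omega>) < u)" if v: "0 < v" "v < u" for v
  proof -
    obtain y where y: "G y = v" using level v u by (meson less_trans)
    have "\<P>(\<omega> in M. X \<omega> \<le> y) \<le> \<P>(\<omega> in M. G (X \<omega>) < u)"
    proof (rule finite_measure_mono)
      show "{\<omega> \<in> space M. X \<omega> \<le> y} \<subseteq> {\<omega> \<in> space M. G (X \<omega>) < u}"
        using mono[of _ y] y v by (auto intro: le_less_trans)
    qed measurable
    then show ?thesis by (simp add: G y)
  qed
  have "u \<le> \<P>(\<omega> in M. G (X \<omega>) < u)"
    by (rule dense_le_bounded[of 0 u]) (use u lower in auto)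
  then have "\<P>(\<omega> in M. G (X \<omega>) < u) = u" using upper by simp
  moreover have "\<P>(\<omega> in M. \<not> G (X \<omega>) < u) = 1 - \<P>(\<omega> in M. G (X \<omega>) < u)"
    by (rule prob_neg) measurable
  ultimately show ?thesis by (simp add: G not_less)
qed

text \<open>To the left of the quantile the distribution function is below \<open>p\<close>, to the
  right at least \<open>p\<close>, so continuity forces the value \<open>p\<close> there. It also
  removes an atom at the quantile, so the closed upper half-line gets mass 1 - p.\<close>

lemma (in real_distribution) measure_at_least_gen_inv:
  assumes cont: "isCont (cdf M) (gen_inv (cdf M) p)" and p: "0 < p" "p < 1"
  shows "measure M {gen_inv (cdf M) p..} = 1 - p"
proof -
  define q where "q = gen_inv (cdf M) p"
  define S where "S = {y. p \<le> cdf M y}"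
  have q: "q = Inf S" by (simp add: q_def gen_inv_def S_def)
  have "\<forall>\<^sub>F y in at_bot. cdf M y < p" "\<forall>\<^sub>F y in at_top. p < cdf M y"
    using p order_tendstoD(2)[OF cdf_lim_at_bot, of p] order_tendstoD(1)[OF cdf_lim_at_top_prob, of p]
    by auto
  \<comment> \<open>These witnesses make \<open>S\<close> bounded below and nonempty, so that
    \<open>Inf S\<close> is a genuine infimum.\<close>
  then obtain x z where x: "cdf M x < p" and z: "p < cdf M z"
    unfolding eventually_at_bot_linorder eventually_at_top_linorder by blast
  have bdd: "bdd_below S"
  proof (rule bdd_belowI)
    fix y assume "y \<in> S"
    then show "x \<le> y" using x cdf_nondecreasing[of y x] by (force simp: S_def)
  qed
  have ne: "S \<noteq> {}" using z less_imp_le unfolding S_def by blast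
  have below: "cdf M y < p" if "y < q" for y
    using that cInf_lower[OF _ bdd, of y] by (force simp: q S_def)
  have above: "p \<le> cdf M y" if yq: "q < y" for y
  proof -
    obtain s where "s \<in> S" "s < y" using yq cInf_less_iff[OF ne bdd] unfolding q by blast
    then show ?thesis using cdf_nondecreasing[of s y] by (simp add: S_def)
  qed
  have lim: "(cdf M \<longlongrightarrow> cdf M q) (at_left q)" "(cdf M \<longlongrightarrow> cdf M q) (at_right q)"
    using cont unfolding q_def[symmetric] isCont_def by (auto simp: filterlim_at_split)
  have "cdf M q \<le> p"
    using below by (intro tendsto_upperbound[OF lim(1)])
      (auto simp: eventually_at_filter less_imp_le intro!: always_eventually)
  moreover have "p \<le> cdf M q"
    using above by (intro tendsto_lowerbound[OF lim(2)])
      (auto simp: eventually_at_filter intro!: always_eventually)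
  ultimately have "cdf M q = p" by simp
  moreover have "cdf M q = measure M {..<q}"
    using tendsto_unique[OF _ lim(1) cdf_at_left] by simp
  moreover have "measure M {q..} = 1 - measure M {..<q}"
    using prob_compl[of "{..<q}"] by (simp add: Compl_eq_Diff_UNIV[symmetric] Compl_lessThan)
  ultimately show ?thesis by (simp add: q_def)
qed

section \<open>Limits for the empirical forecast rank of the autoregression\<close>

theorem theorem6:
  fixes M :: "'a measure"
    and d h :: nat and t :: int and p :: real
    and \<phi> :: "nat \<Rightarrow> real"
    and \<epsilon> Y :: "int \<Rightarrow> 'a \<Rightarrow> real"
    and \<phi>hat :: "nat \<Rightarrow> 'a \<Rightarrow> nat \<Rightarrow> real"
  assumes P: "prob_space M"
    and d: "d \<ge> 1" and h: "h \<ge> 1" and p: "0 < p" "p < 1"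
    \<comment> \<open>causality: the AR polynomial has no roots in the closed unit disk\<close>
    and roots: "\<forall>z::complex. cmod z \<le> 1 \<longrightarrow> 1 - (\<Sum>i=1..d. complex_of_real (\<phi> i) * z ^ i) \<noteq> 0"
    \<comment> \<open>iid innovations with a Lebesgue density and a finite delta-moment\<close>
    and eps_rv: "\<forall>s. \<epsilon> s \<in> borel_measurable M"
    and eps_indep: "prob_space.indep_vars M (\<lambda>_. borel) \<epsilon> UNIV"
    and eps_id: "\<forall>s. distr M borel (\<epsilon> s) = distr M borel (\<epsilon> 0)"
    and eps_dens: "\<exists>f. distributed M lborel (\<epsilon> 0) f"
    and eps_mom: "\<exists>\<delta>>0. integrable M (\<lambda>\<omega>. \<bar>\<epsilon> 0 \<omega>\<bar> powr \<delta>)"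
    \<comment> \<open>Y is the stationary causal solution\<close>
    and Y_rv: "\<forall>s. Y s \<in> borel_measurable M"
    and Y_ma: "\<forall>s. AE \<omega> in M. (\<lambda>i. ma_coeff d \<phi> i * \<epsilon> (s - int i) \<omega>) sums Y s \<omega>"
    and Y_ar: "\<forall>s. AE \<omega> in M. Y s \<omega> = (\<Sum>i=1..d. \<phi> i * Y (s - int i) \<omega>) + \<epsilon> s \<omega>"
    and eps_past: "\<forall>s. prob_space.indep_set M
                      (sigma_sets (space M) {\<epsilon> s -` B \<inter> space M | B. B \<in> sets borel})
                      (sigma_sets (space M) {Y r -` B \<inter> space M | r B. r \<le> s - 1 \<and> B \<in> sets borel})"
    \<comment> \<open>the estimator: a random vector depending on the observations Y_t, ..., Y_(t-n+1)\<close>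
    and est_rv: "\<forall>n. \<forall>i\<in>{1..d}. (\<lambda>\<omega>. \<phi>hat n \<omega> i) \<in> borel_measurable M"
    and est_obs: "\<forall>n. \<exists>g. \<forall>\<omega>\<in>space M. \<phi>hat n \<omega> = g (\<lambda>k\<in>{..<n}. Y (t - int k) \<omega>)"
    and est_cons: "\<forall>i\<in>{1..d}. \<forall>e>0.
                     (\<lambda>n. \<P>(\<omega> in M. \<bar>\<phi>hat n \<omega> i - \<phi> i\<bar> > e)) \<longlonglongrightarrow> 0"
    \<comment> \<open>the oracle point forecast has a Lebesgue density\<close>
    and Yhat_dens: "\<exists>g. distributed M lborel
                      (\<lambda>\<omega>. \<Sum>i<d. phi_h d \<phi> h i * Y (t - int i) \<omega>) g"
    \<comment> \<open>the marginal CDF of Y_t is continuous at its p-quantile\<close>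
    and F_cont: "isCont (\<lambda>y. \<P>(\<omega> in M. Y t \<omega> \<le> y))
                   (gen_inv (\<lambda>y. \<P>(\<omega> in M. Y t \<omega> \<le> y)) p)"
  shows
    "let F = (\<lambda>y. \<P>(\<omega> in M. Y t \<omega> \<le> y));
         q = gen_inv F p;
         Uhat = (\<lambda>n \<omega>. (1 / real (n - d + 1)) *
                  (\<Sum>k=0..n - d. if (\<Sum>i<d. phi_h d (\<phi>hat n \<omega>) h i * Y (t - int k - int i) \<omega>)
                                        \<le> (\<Sum>i<d. phi_h d (\<phi>hat n \<omega>) h i * Y (t - int i) \<omega>)
                                   then 1 else 0));
         W = (\<lambda>\<omega>. \<Sum>i<d. phi_h d \<phi> h i * Y (t - int i) \<omega>);
         Ustar = (\<lambda>\<omega>. \<P>(\<omega>' in M. W \<omega>' \<le> W \<omega>))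
     in ((\<lambda>n. \<P>(\<omega> in M. Uhat n \<omega> \<ge> p)) \<longlonglongrightarrow> 1 - p)
        \<and> 1 - p = \<P>(\<omega> in M. Y (t + int h) \<omega> \<ge> q)
        \<and> ((\<lambda>n. \<P>(\<omega> in M. Y (t + int h) \<omega> \<ge> q \<bar> Uhat n \<omega> \<ge> p))
             \<longlonglongrightarrow> \<P>(\<omega> in M. Y (t + int h) \<omega> \<ge> q \<bar> Ustar \<omega> \<ge> p))"
proof -
  interpret prob_space M by (rule P)
  define a where "a = ma_coeff d \<phi>"
  define c where "c = phi_h d \<phi> h"
  define W where "W s \<omega> = (\<Sum>i<d. c i * Y (s - int i) \<omega>)" for s \<omega>
  define F where "F y = \<P>(\<omega> in M. Y t \<omega> \<le> y)" for y
  define q where "q = gen_inv F p"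
  \<comment> \<open>The independent copy enters the oracle rank only through its law, so this rank
    is the distribution function of the forecast evaluated at the forecast.\<close>
  define A where "A \<omega> \<longleftrightarrow> p \<le> \<P>(\<omega>' in M. W t \<omega>' \<le> W t \<omega>)" for \<omega>
  define B where "B n \<omega> \<longleftrightarrow> p \<le> (1 / real (n - d + 1)) * (\<Sum>k=0..n - d.
    if (\<Sum>i<d. phi_h d (\<phi>hat n \<omega>) h i * Y (t - int k - int i) \<omega>)
      \<le> (\<Sum>i<d. phi_h d (\<phi>hat n \<omega>) h i * Y (t - int i) \<omega>) then 1 else 0)" for n \<omega>
  have Y[measurable]: "Y s \<in> borel_measurable M" for s using Y_rv by blast
  have W[measurable]: "W s \<in> borel_measurable M" for s unfolding W_def by measurable
  have rv: "\<epsilon> s \<in> borel_measurable M" and id: "distr M borel (\<epsilon> s) = distr M borel (\<epsilon> 0)"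
    and ma: "AE \<omega> in M. (\<lambda>i. a i * \<epsilon> (s - int i) \<omega>) sums Y s \<omega>" for s
    using eps_rv eps_id Y_ma by (auto simp: a_def)
  note stationary = causal_process_stationary[OF rv eps_indep id Y ma]
  have comp: "(\<lambda>x. x i) \<in> borel_measurable (\<Pi>\<^sub>M i\<in>(UNIV::nat set). (borel :: real measure))" for i
    by (rule measurable_component_singleton) simp

  have atomless: "\<P>(\<omega> in M. W t \<omega> = y) = 0" for y
  proof -
    obtain g where g: "distributed M lborel (W t) g"
      using Yhat_dens by (auto simp: W_def[abs_def] c_def)
    have "emeasure (distr M lborel (W t)) {y} = emeasure (density lborel g) {y}"
      using g by (simp add: distributed_def)
    also have "\<dots> = 0"
      using g by (subst emeasure_density)
        (auto simp: distributed_def intro!: nn_integral_0_iff_AE[THEN iffD2] AE_mp[OF AE_lborel_singleton[of y]])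
    finally have "emeasure M (W t -` {y} \<inter> space M) = 0"
      using g by (subst (asm) emeasure_distr) (auto simp: distributed_def)
    then show ?thesis by (simp add: measure_def vimage_def Int_def conj_commute)
  qed

  have chat: "(\<lambda>\<omega>. phi_h d (\<phi>hat n \<omega>) h i) \<in> borel_measurable M" if "i < d" for n i
    using est_rv that by (intro measurable_phi_h) auto
  have diff: "(\<lambda>n. \<P>(\<omega> in M. B n \<omega> \<noteq> A \<omega>)) \<longlonglongrightarrow> 0"
  proof -
    \<comment> \<open>The subtracted \<open>int 0\<close> matches the instance of \<open>Z k\<close>
      at \<open>k\<close> = 0 in the rank lemma.\<close>
    have tail: "\<P>(\<omega> in M. (\<Sum>i<d. \<bar>Y (t - int k - int i) \<omega>\<bar>) > K) =
        \<P>(\<omega> in M. (\<Sum>i<d. \<bar>Y (t - int 0 - int i) \<omega>\<bar>) > K)" for k K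
    proof (rule stationary[where Q="\<lambda>x. (\<Sum>i<d. \<bar>x i\<bar>) > K"])
      show "Measurable.pred (\<Pi>\<^sub>M i\<in>(UNIV::nat set). (borel :: real measure)) (\<lambda>x. (\<Sum>i<d. \<bar>x i\<bar>) > K)"
        using comp by measurable
    qed
    have lln: "(\<lambda>N. \<P>(\<omega> in M. \<delta> \<le> \<bar>(\<Sum>k<N. indicator {\<omega>\<in>space M. W (t - int k) \<omega> \<le> y} \<omega>) / real N
        - \<P>(\<omega> in M. W (t - int 0) \<omega> \<le> y)\<bar>)) \<longlonglongrightarrow> 0" if "\<delta> > 0" for y \<delta>
      using causal_process_weak_law[OF rv eps_indep id Y ma atomless[unfolded W_def] that, of y]
      by (simp add: W_def)
    \<comment> \<open>The number of lag vectors in the empirical rank; with natural subtraction it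
      is at least 1 for every \<open>n\<close>.\<close>
    have N: "filterlim (\<lambda>n. n - d + 1) at_top sequentially"
      by (rule filterlim_at_top_mono[OF filterlim_minus_const_nat_at_top[of d]]) simp
    have cons: "(\<lambda>n. \<P>(\<omega> in M. (\<Sum>i<d. \<bar>phi_h d (\<phi>hat n \<omega>) h i - c i\<bar>) > \<eta>)) \<longlonglongrightarrow> 0" if "\<eta> > 0" for \<eta>
      unfolding c_def using est_rv est_cons that by (intro phi_h_consistent) auto
    have atomless': "\<P>(\<omega> in M. (\<Sum>i<d. c i * Y (t - int 0 - int i) \<omega>) = y) = 0" for y
      using atomless[of y] by (simp add: W_def)
    have range: "{0..n - d} = {..<n - d + 1}" for n by auto
    show ?thesis
      using empirical_rank_event_limit[where Z="\<lambda>k i. Y (t - int k - int i)" and c=c and d=d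
          and chat="\<lambda>n i \<omega>. phi_h d (\<phi>hat n \<omega>) h i" and N="\<lambda>n. n - d + 1",
          OF Y chat tail lln[unfolded W_def] atomless' cons N p]
      unfolding A_def B_def W_def range by simp
  qed

  have [measurable]: "Measurable.pred M A"
  proof -
    have "mono (\<lambda>y. \<P>(\<omega> in M. W t \<omega> \<le> y))"
      by (intro monoI finite_measure_mono) auto
    then have "(\<lambda>y. \<P>(\<omega> in M. W t \<omega> \<le> y)) \<in> borel_measurable borel"
      by (rule borel_measurable_mono)
    from measurable_compose[OF W this, of t] show ?thesis
      unfolding A_def by measurable
  qed
  have [measurable]: "Measurable.pred M (B n)" for n
    unfolding B_def using chat by measurable

  have prob_A: "\<P>(\<omega> in M. A \<omega>) = 1 - p"
    unfolding A_def by (rule probability_integral_transform[OF W atomless p])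
  have prob_H: "\<P>(\<omega> in M. q \<le> Y (t + int h) \<omega>) = 1 - p"
  proof -
    interpret D: real_distribution "distr M borel (Y t)" by (rule real_distribution_distr) simp
    have F: "F = cdf (distr M borel (Y t))"
      by (simp add: fun_eq_iff F_def cdf_def measure_distr vimage_def Int_def conj_commute)
    have "\<P>(\<omega> in M. q \<le> Y (t + int h - int 0) \<omega>) = \<P>(\<omega> in M. q \<le> Y (t - int 0) \<omega>)"
    proof (rule stationary[where Q="\<lambda>x. q \<le> x 0"])
      show "Measurable.pred (\<Pi>\<^sub>M i\<in>(UNIV::nat set). (borel :: real measure)) (\<lambda>x. q \<le> x 0)"
        using comp by measurable
    qed
    also have "\<dots> = measure (distr M borel (Y t)) {q..}"
      by (simp add: measure_distr vimage_def Int_def conj_commute)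
    also have "\<dots> = 1 - p"
      using D.measure_at_least_gen_inv[OF _ p] F_cont
      unfolding q_def F[symmetric] F_def[abs_def] by blast
    finally show ?thesis by simp
  qed
  have lim_B: "(\<lambda>n. \<P>(\<omega> in M. B n \<omega>)) \<longlonglongrightarrow> 1 - p"
    unfolding prob_A[symmetric] by (rule tendsto_prob_of_diff[OF _ _ diff]) measurable
  \<comment> \<open>Intersecting with a fixed event can only shrink the set where the two rank
    events differ.\<close>
  have "(\<lambda>n. \<P>(\<omega> in M. q \<le> Y (t + int h) \<omega> \<and> B n \<omega>)) \<longlonglongrightarrow>
      \<P>(\<omega> in M. q \<le> Y (t + int h) \<omega> \<and> A \<omega>)"
  proof (rule tendsto_prob_of_diff)
    have "\<P>(\<omega> in M. (q \<le> Y (t + int h) \<omega> \<and> B n \<omega>) \<noteq> (q \<le> Y (t + int h) \<omega> \<and> A \<omega>))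
        \<le> \<P>(\<omega> in M. B n \<omega> \<noteq> A \<omega>)" for n
      by (rule finite_measure_mono) auto
    then show "(\<lambda>n. \<P>(\<omega> in M. (q \<le> Y (t + int h) \<omega> \<and> B n \<omega>) \<noteq> (q \<le> Y (t + int h) \<omega> \<and> A \<omega>))) \<longlonglongrightarrow> 0"
      by (intro tendsto_sandwich[OF _ _ tendsto_const diff] always_eventually) auto
  qed measurable
  \<comment> \<open>Numerator and denominator converge separately, and the limit 1 - p of the
    denominator is nonzero because \<open>p < 1\<close>.\<close>
  then have "(\<lambda>n. \<P>(\<omega> in M. q \<le> Y (t + int h) \<omega> \<bar> B n \<omega>)) \<longlonglongrightarrow>
      \<P>(\<omega> in M. q \<le> Y (t + int h) \<omega> \<bar> A \<omega>)"
    unfolding cond_prob_def prob_A using lim_B p by (intro tendsto_divide) auto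
  then show ?thesis
    unfolding Let_def F_def[abs_def, symmetric] q_def[symmetric]
    using lim_B prob_H by (simp add: A_def B_def W_def c_def)
qed

end
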